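(* Let $\Omega=\bigcup_{i=1}^n(\alpha_i,\beta_i)$ be a finite union of finite open intervals as in the context. Suppose $\Omega$ is spectral with spectrum $\Lambda$, associated boundary matrix $B$ and associated unitary group $\{U(t)\}_{t\in\mathbb R}$, and suppose $\{U(t)\}$ is multiplicative. (i) $B=P^\sigma$ where $\sigma\in S_n$ is a cycle of length $n$. (ii) Let $L:=\mathfrak m(\Omega)=l_1+\dots+l_n$. Then $\Lambda=\frac1L\mathbb Z$ and $\Omega$ tiles $\mathbb R$ with tiling set $L\mathbb Z$. (iii) For $1\le k\le n-1$ put $$\tau_k=(\beta_1-\alpha_{\sigma(1)})+(\beta_{\sigma(1)}-\alpha_{\sigma^2(1)})+\dots+(\beta_{\sigma^{k-1}(1)}-\alpha_{\sigma^k(1)}).$$ Then for each $1\le k\le n-1$ $$(\alpha_{\sigma^k(1)},\beta_{\sigma^k(1)})+\tau_k=\Big(\alpha_1+\sum_{j=0}^{k-1}l_{\sigma^j(1)},\ \alpha_1+\sum_{j=0}^{k}l_{\sigma^j(1)}\Big)$$ (that is, the interval with index $\sigma^k(1)$ is moved to the end of the previously moved one, starting from $(\alpha_1,\beta_1)$). The union of $(\alpha_1,\beta_1)$ and of these translated intervals is $(\alpha_1,\alpha_1+L)$ except for finitely many points; all the translations $\tau_k$ are in $L\mathbb Z$; and consequently these translations show that $\Omega$ is translation congruent to $(\alpha_1,\alpha_1+L)$ modulo $L\mathbb Z$.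
   Context: Setting: $n\ge 1$, $-\infty<\alpha_1<\beta_1<\alpha_2<\beta_2<\dots<\alpha_n<\beta_n<\infty$, $\Omega=\bigcup_{i=1}^n(\alpha_i,\beta_i)$, $l_i=\beta_i-\alpha_i$; $\mathfrak m$ is Lebesgue measure. $\mathscr D$ is the set of $f\in L^2(\Omega)$ absolutely continuous on each interval with $f'\in L^2(\Omega)$; $f(\alpha_i),f(\beta_i)$ denote the one-sided limits $f(\alpha_i+),f(\beta_i-)$, and $f(\vec\alpha)=(f(\alpha_i))_{i=1}^n$, $f(\vec\beta)=(f(\beta_i))_{i=1}^n$. For a unitary $n\times n$ matrix $B$, $\mathscr D_B=\{f\in\mathscr D: Bf(\vec\alpha)=f(\vec\beta)\}$, $D_Bf=\frac1{2\pi\mathrm i}f'$ with domain $\mathscr D_B$ (a self-adjoint operator), and $U(t)=\exp(2\pi\mathrm i tD_B)$. With $e_\lambda(x)=e^{2\pi\mathrm i\lambda x}$, $\Omega$ is spectral with spectrum $\Lambda\subset\mathbb R$ if $\{e_\lambda:\lambda\in\Lambda\}$ is an orthogonal basis of $L^2(\Omega)$. In that case there is a unique unitary matrix $B$ with $Be_\lambda(\vec\alpha)=e_\lambda(\vec\beta)$ for all $\lambda\in\Lambda$ (the associated boundary matrix), and $\Lambda$ is the spectrum of $D_B$; the associated unitary group is that of this $B$. $U(t)$ is multiplicative if $U(t)(fg)=U(t)f\cdot U(t)g$ for all $f,g\in L^2(\Omega)$ with $fg\in L^2(\Omega)$; the group $\{U(t)\}$ is multiplicative if $U(t)$ is multiplicative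 for all $t\in\mathbb R$. For $\sigma\in S_n$, $P^\sigma$ is the matrix with $P^\sigma_{i,j}=1$ if $\sigma(i)=j$ and $0$ otherwise. $\Omega$ tiles $\mathbb R$ with tiling set $\mathcal T$ if $\{\Omega+t:t\in\mathcal T\}$ is a partition of $\mathbb R$ up to measure zero. Two measurable sets $A,A'\subset\mathbb R$ are translation congruent modulo $L\mathbb Z$ if there are at most countable measurable partitions $\{A_i\}_{i\in I}$ of $A$ and $\{A'_i\}_{i\in I}$ of $A'$ and integers $k_i$ with $A_i+k_iL=A'_i$ up to measure zero. *)

theory Defs
  imports "HOL-Analysis.Analysis" "HOL-Combinatorics.Cycles" "Jordan_Normal_Form.Schur_Decomposition"
begin

text \<open>
  Indices run over \<open>0, \<dots>, n - 1\<close>; in particular the interval with index \<open>1\<close> in the usual notation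
  is the one with index \<open>0\<close> here.  Vectors and matrices indexed by the intervals are those of
  Jordan Normal Form.
\<close>

definition interval_union :: "nat \<Rightarrow> (nat \<Rightarrow> real) \<Rightarrow> (nat \<Rightarrow> real) \<Rightarrow> real set" where
  "interval_union n \<alpha> \<beta> = (\<Union>i<n. {\<alpha> i<..<\<beta> i})"

definition unitary_matrix :: "nat \<Rightarrow> complex mat \<Rightarrow> bool" where
  "unitary_matrix n B \<longleftrightarrow>
     B \<in> carrier_mat n n \<and> mat_adjoint B * B = 1\<^sub>m n \<and> B * mat_adjoint B = 1\<^sub>m n"

definition permutation_matrix :: "nat \<Rightarrow> (nat \<Rightarrow> nat) \<Rightarrow> complex mat" where
  "permutation_matrix n \<sigma> = Matrix.mat n n (\<lambda>(i, j). if \<sigma> i = j then 1 else 0)"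

text \<open>
  For \<open>n = 1\<close> the identity is a cycle of length \<open>1\<close>, in accordance with \<^const>\<open>cycle_of_list\<close>.
\<close>

definition full_cycle :: "nat \<Rightarrow> (nat \<Rightarrow> nat) \<Rightarrow> bool" where
  "full_cycle n \<sigma> \<longleftrightarrow>
     \<sigma> permutes {..<n} \<and>
     (\<exists>cs. cycle cs \<and> length cs = n \<and> set cs = {..<n} \<and> \<sigma> = cycle_of_list cs)"


section \<open>The Hilbert space of square integrable functions\<close>

text \<open>
  Elements of \<open>L\<^sup>2(\<Omega>)\<close> are represented by functions, and equality in \<open>L\<^sup>2(\<Omega>)\<close> is equality almost
  everywhere on \<open>\<Omega>\<close>.  The values of a representative outside \<open>\<Omega>\<close> are irrelevant.
\<close>

definition L2 :: "real set \<Rightarrow> (real \<Rightarrow> complex) set" where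
  "L2 \<Omega> = {f \<in> borel_measurable (lebesgue_on \<Omega>).
             integrable (lebesgue_on \<Omega>) (\<lambda>x. (cmod (f x))\<^sup>2)}"

abbreviation L2_eq :: "real set \<Rightarrow> (real \<Rightarrow> complex) \<Rightarrow> (real \<Rightarrow> complex) \<Rightarrow> bool" where
  "L2_eq \<Omega> f g \<equiv> (AE x in lebesgue_on \<Omega>. f x = g x)"

definition L2_inner :: "real set \<Rightarrow> (real \<Rightarrow> complex) \<Rightarrow> (real \<Rightarrow> complex) \<Rightarrow> complex" where
  "L2_inner \<Omega> f g = integral\<^sup>L (lebesgue_on \<Omega>) (\<lambda>x. f x * cnj (g x))"

definition L2_norm :: "real set \<Rightarrow> (real \<Rightarrow> complex) \<Rightarrow> real" where
  "L2_norm \<Omega> f = sqrt (integral\<^sup>L (lebesgue_on \<Omega>) (\<lambda>x. (cmod (f x))\<^sup>2))"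

definition L2_linear :: "real set \<Rightarrow> ((real \<Rightarrow> complex) \<Rightarrow> (real \<Rightarrow> complex)) \<Rightarrow> bool" where
  "L2_linear \<Omega> T \<longleftrightarrow>
     (\<forall>f\<in>L2 \<Omega>. T f \<in> L2 \<Omega>) \<and>
     (\<forall>f\<in>L2 \<Omega>. \<forall>g\<in>L2 \<Omega>. \<forall>a b.
        L2_eq \<Omega> (T (\<lambda>x. a * f x + b * g x)) (\<lambda>x. a * T f x + b * T g x))"


section \<open>Spectral sets\<close>

definition expo :: "real \<Rightarrow> real \<Rightarrow> complex" where
  "expo \<xi> x = exp (2 * of_real pi * \<i> * of_real \<xi> * of_real x)"

definition spectral_with :: "real set \<Rightarrow> real set \<Rightarrow> bool" where
  "spectral_with \<Omega> \<Lambda> \<longleftrightarrow>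
     (\<forall>\<xi>\<in>\<Lambda>. \<forall>\<eta>\<in>\<Lambda>. \<xi> \<noteq> \<eta> \<longrightarrow> L2_inner \<Omega> (expo \<xi>) (expo \<eta>) = 0) \<and>
     (\<forall>f\<in>L2 \<Omega>. \<forall>\<epsilon>>0. \<exists>F c. finite F \<and> F \<subseteq> \<Lambda> \<and>
        L2_norm \<Omega> (\<lambda>x. f x - (\<Sum>\<xi>\<in>F. c \<xi> * expo \<xi> x)) < \<epsilon>)"


section \<open>The operators \<open>D\<^sub>B\<close>\<close>

definition abs_continuous :: "real \<Rightarrow> real \<Rightarrow> (real \<Rightarrow> complex) \<Rightarrow> bool" where
  "abs_continuous a b f \<longleftrightarrow>
     (\<forall>\<epsilon>>0. \<exists>\<delta>>0. \<forall>(N::nat) u v.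
        (\<forall>i<N. a < u i \<and> u i \<le> v i \<and> v i < b) \<and>
        disjoint_family_on (\<lambda>i. {u i<..<v i}) {..<N} \<and>
        (\<Sum>i<N. v i - u i) < \<delta> \<longrightarrow>
        (\<Sum>i<N. cmod (f (v i) - f (u i))) < \<epsilon>)"

definition left_values :: "nat \<Rightarrow> (nat \<Rightarrow> real) \<Rightarrow> (real \<Rightarrow> complex) \<Rightarrow> complex Matrix.vec" where
  "left_values n \<alpha> f = Matrix.vec n (\<lambda>i. Lim (at_right (\<alpha> i)) f)"

definition right_values :: "nat \<Rightarrow> (nat \<Rightarrow> real) \<Rightarrow> (real \<Rightarrow> complex) \<Rightarrow> complex Matrix.vec" where
  "right_values n \<beta> f = Matrix.vec n (\<lambda>i. Lim (at_left (\<beta> i)) f)"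

text \<open>
  The absolutely continuous representatives of the elements of the space \<open>\<D>\<close>.  An absolutely
  continuous function is differentiable almost everywhere, and the value of
  \<^const>\<open>vector_derivative\<close> at the exceptional points is immaterial.
\<close>

definition D_space ::
  "nat \<Rightarrow> (nat \<Rightarrow> real) \<Rightarrow> (nat \<Rightarrow> real) \<Rightarrow> (real \<Rightarrow> complex) set" where
  "D_space n \<alpha> \<beta> = {f \<in> L2 (interval_union n \<alpha> \<beta>).
      (\<forall>i<n. abs_continuous (\<alpha> i) (\<beta> i) f) \<and>
      (\<lambda>x. vector_derivative f (at x)) \<in> L2 (interval_union n \<alpha> \<beta>)}"

definition D_space_B ::
  "nat \<Rightarrow> (nat \<Rightarrow> real) \<Rightarrow> (nat \<Rightarrow> real) \<Rightarrow> complex mat \<Rightarrow> (real \<Rightarrow> complex) set" where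
  "D_space_B n \<alpha> \<beta> B =
     {f \<in> D_space n \<alpha> \<beta>. B *\<^sub>v left_values n \<alpha> f = right_values n \<beta> f}"

text \<open>
  An unbounded operator on \<open>L\<^sup>2(\<Omega>)\<close> is given by its graph, a set of pairs of representatives closed
  under equality almost everywhere.
\<close>

definition D_op ::
  "nat \<Rightarrow> (nat \<Rightarrow> real) \<Rightarrow> (nat \<Rightarrow> real) \<Rightarrow> complex mat \<Rightarrow>
     ((real \<Rightarrow> complex) \<times> (real \<Rightarrow> complex)) set" where
  "D_op n \<alpha> \<beta> B =
     {(f, g). f \<in> L2 (interval_union n \<alpha> \<beta>) \<and> g \<in> L2 (interval_union n \<alpha> \<beta>) \<and>
        (\<exists>h\<in>D_space_B n \<alpha> \<beta> B.
           L2_eq (interval_union n \<alpha> \<beta>) f h \<and>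
           L2_eq (interval_union n \<alpha> \<beta>) g
             (\<lambda>x. 1 / (2 * of_real pi * \<i>) * vector_derivative h (at x)))}"


section \<open>Functional calculus and the group \<open>exp (2 \<pi> \<i> t A)\<close>\<close>

text \<open>
  For a self-adjoint operator \<open>A\<close> with spectral measure \<open>E\<close>, i.e. \<open>A = \<integral> x dE(x)\<close>, the operator
  \<open>exp (2 \<pi> \<i> t A)\<close> is \<open>\<integral> exp (2 \<pi> \<i> t x) dE(x)\<close>.  Spectral integrals are understood weakly, through
  the finite measures \<open>S \<mapsto> \<langle>E(S) f, f\<rangle>\<close>, as is standard for the Borel functional calculus: the
  quadratic form of a linear operator determines the operator by polarization.
\<close>

definition L2_projection :: "real set \<Rightarrow> ((real \<Rightarrow> complex) \<Rightarrow> (real \<Rightarrow> complex)) \<Rightarrow> bool" where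
  "L2_projection \<Omega> P \<longleftrightarrow>
     L2_linear \<Omega> P \<and>
     (\<forall>f\<in>L2 \<Omega>. L2_eq \<Omega> (P (P f)) (P f)) \<and>
     (\<forall>f\<in>L2 \<Omega>. \<forall>g\<in>L2 \<Omega>. L2_inner \<Omega> (P f) g = L2_inner \<Omega> f (P g))"

definition projection_valued_measure ::
  "real set \<Rightarrow> (real set \<Rightarrow> (real \<Rightarrow> complex) \<Rightarrow> (real \<Rightarrow> complex)) \<Rightarrow> bool" where
  "projection_valued_measure \<Omega> E \<longleftrightarrow>
     (\<forall>S\<in>sets borel. L2_projection \<Omega> (E S)) \<and>
     (\<forall>f\<in>L2 \<Omega>. L2_eq \<Omega> (E {} f) (\<lambda>x. 0) \<and> L2_eq \<Omega> (E UNIV f) f) \<and>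
     (\<forall>S\<in>sets borel. \<forall>T\<in>sets borel. \<forall>f\<in>L2 \<Omega>. L2_eq \<Omega> (E (S \<inter> T) f) (E S (E T f))) \<and>
     (\<forall>S :: nat \<Rightarrow> real set. range S \<subseteq> sets borel \<and> disjoint_family S \<longrightarrow>
        (\<forall>f\<in>L2 \<Omega>.
          (\<lambda>N. L2_norm \<Omega> (\<lambda>x. E (\<Union>i. S i) f x - (\<Sum>i<N. E (S i) f x))) \<longlonglongrightarrow> 0))"

definition spectral_form_measure ::
  "real set \<Rightarrow> (real set \<Rightarrow> (real \<Rightarrow> complex) \<Rightarrow> (real \<Rightarrow> complex)) \<Rightarrow> (real \<Rightarrow> complex) \<Rightarrow>
     real measure" where
  "spectral_form_measure \<Omega> E f =
     measure_of UNIV (sets borel) (\<lambda>S. ennreal (Re (L2_inner \<Omega> (E S f) f)))"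

text \<open>\<open>E\<close> is the spectral measure of the operator with graph \<open>A\<close>.\<close>

definition spectral_measure_of ::
  "real set \<Rightarrow> ((real \<Rightarrow> complex) \<times> (real \<Rightarrow> complex)) set \<Rightarrow>
     (real set \<Rightarrow> (real \<Rightarrow> complex) \<Rightarrow> (real \<Rightarrow> complex)) \<Rightarrow> bool" where
  "spectral_measure_of \<Omega> A E \<longleftrightarrow>
     projection_valued_measure \<Omega> E \<and>
     (\<forall>f\<in>L2 \<Omega>. f \<in> Domain A \<longleftrightarrow> integrable (spectral_form_measure \<Omega> E f) (\<lambda>x. x\<^sup>2)) \<and>
     (\<forall>(f, g)\<in>A. L2_inner \<Omega> g f =
        of_real (integral\<^sup>L (spectral_form_measure \<Omega> E f) (\<lambda>x. x)))"

text \<open>\<open>T = \<integral> \<phi> dE\<close>, for a bounded Borel function \<open>\<phi>\<close>.\<close>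

definition spectral_integral ::
  "real set \<Rightarrow> (real set \<Rightarrow> (real \<Rightarrow> complex) \<Rightarrow> (real \<Rightarrow> complex)) \<Rightarrow> (real \<Rightarrow> complex) \<Rightarrow>
     ((real \<Rightarrow> complex) \<Rightarrow> (real \<Rightarrow> complex)) \<Rightarrow> bool" where
  "spectral_integral \<Omega> E \<phi> T \<longleftrightarrow>
     L2_linear \<Omega> T \<and>
     (\<forall>f\<in>L2 \<Omega>. L2_inner \<Omega> (T f) f = integral\<^sup>L (spectral_form_measure \<Omega> E f) \<phi>)"

text \<open>\<open>U t = exp (2 \<pi> \<i> t A)\<close> for all \<open>t\<close>.\<close>

definition unitary_group_of ::
  "real set \<Rightarrow> ((real \<Rightarrow> complex) \<times> (real \<Rightarrow> complex)) set \<Rightarrow>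
     (real \<Rightarrow> (real \<Rightarrow> complex) \<Rightarrow> (real \<Rightarrow> complex)) \<Rightarrow> bool" where
  "unitary_group_of \<Omega> A U \<longleftrightarrow>
     (\<exists>E. spectral_measure_of \<Omega> A E \<and>
        (\<forall>t. spectral_integral \<Omega> E
               (\<lambda>x. exp (2 * of_real pi * \<i> * of_real t * of_real x)) (U t)))"

definition multiplicative_group ::
  "real set \<Rightarrow> (real \<Rightarrow> (real \<Rightarrow> complex) \<Rightarrow> (real \<Rightarrow> complex)) \<Rightarrow> bool" where
  "multiplicative_group \<Omega> U \<longleftrightarrow>
     (\<forall>t. \<forall>f\<in>L2 \<Omega>. \<forall>g\<in>L2 \<Omega>. (\<lambda>x. f x * g x) \<in> L2 \<Omega> \<longrightarrow>
        L2_eq \<Omega> (U t (\<lambda>x. f x * g x)) (\<lambda>x. U t f x * U t g x))"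


section \<open>Tiling and translation congruence\<close>

definition tiles_reals :: "real set \<Rightarrow> real set \<Rightarrow> bool" where
  "tiles_reals \<Omega> \<T> \<longleftrightarrow>
     (\<forall>s\<in>\<T>. \<forall>t\<in>\<T>. s \<noteq> t \<longrightarrow> (+) s ` \<Omega> \<inter> (+) t ` \<Omega> \<in> null_sets lebesgue) \<and>
     UNIV - (\<Union>t\<in>\<T>. (+) t ` \<Omega>) \<in> null_sets lebesgue"

text \<open>
  The partitions \<open>P\<close> of \<open>A\<close> and \<open>P'\<close> of \<open>A'\<close> and the integers \<open>k\<close> witness that \<open>A\<close> and \<open>A'\<close> are
  translation congruent modulo \<open>L \<int>\<close>.
\<close>

definition translation_congruence_via ::
  "real \<Rightarrow> real set \<Rightarrow> real set \<Rightarrow> nat set \<Rightarrow> (nat \<Rightarrow> real set) \<Rightarrow> (nat \<Rightarrow> real set) \<Rightarrow>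
     (nat \<Rightarrow> int) \<Rightarrow> bool" where
  "translation_congruence_via L A A' I P P' k \<longleftrightarrow>
     (\<forall>i\<in>I. P i \<in> sets lebesgue \<and> P' i \<in> sets lebesgue) \<and>
     disjoint_family_on P I \<and> (\<Union>i\<in>I. P i) = A \<and>
     disjoint_family_on P' I \<and> (\<Union>i\<in>I. P' i) = A' \<and>
     (\<forall>i\<in>I. sym_diff ((\<lambda>x. x + of_int (k i) * L) ` P i) (P' i) \<in> null_sets lebesgue)"

definition translation_congruent :: "real \<Rightarrow> real set \<Rightarrow> real set \<Rightarrow> bool" where
  "translation_congruent L A A' \<longleftrightarrow>
     (\<exists>I P P' k. translation_congruence_via L A A' I P P' k)"

text \<open>
  The total translation \<open>\<tau>\<^sub>k\<close> of the interval with index \<open>\<sigma>\<^sup>k(0)\<close>; \<open>\<tau>\<^sub>0 = 0\<close>.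
\<close>

definition shift :: "(nat \<Rightarrow> real) \<Rightarrow> (nat \<Rightarrow> real) \<Rightarrow> (nat \<Rightarrow> nat) \<Rightarrow> nat \<Rightarrow> real" where
  "shift \<alpha> \<beta> \<sigma> k = (\<Sum>j<k. \<beta> ((\<sigma> ^^ j) 0) - \<alpha> ((\<sigma> ^^ Suc j) 0))"

end

theory Submission
  imports Defs
begin

text \<open>
  The exponentials \<open>e\<^sub>\<xi>\<close> with \<open>\<xi> \<in> \<Lambda>\<close> are eigenvectors of \<open>D\<^sub>B\<close>, so \<open>U(t) e\<^sub>\<xi> = exp (2 \<pi> \<i> t \<xi>) e\<^sub>\<xi>\<close>.  As
  \<open>e\<^sub>\<xi>\<^sub>-\<^sub>\<eta> e\<^sub>\<eta> = e\<^sub>\<xi>\<close>, multiplicativity gives the same identity for \<open>e\<^sub>\<xi>\<^sub>-\<^sub>\<eta>\<close>, and since the family is a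
  maximal orthogonal one, \<open>\<Lambda>\<close> is a group.  It is discrete because \<open>\<langle>e\<^sub>\<xi>, e\<^sub>0\<rangle> \<noteq> 0\<close> for small \<open>\<xi>\<close>; hence
  \<open>\<Lambda> = (1/T) \<int>\<close> for some \<open>T > 0\<close>.  Completeness of these \<open>T\<close>-periodic functions in \<open>L\<^sup>2(\<Omega>)\<close> makes the translates
  of \<open>\<Omega>\<close> by \<open>T \<int>\<close> disjoint.  The boundary condition \<open>B e\<^sub>\<xi>(\<alpha>) = e\<^sub>\<xi>(\<beta>)\<close> holds for all powers of the
  single function \<open>e\<^bsub>1/T\<^esub>\<close>, hence for all polynomials in it; Lagrange interpolation at the distinct
  points \<open>e\<^bsub>1/T\<^esub>(\<alpha>\<^sub>j)\<close> shows that each \<open>\<beta>\<^sub>i\<close> is congruent modulo \<open>T\<close> to exactly one \<open>\<alpha>\<^sub>j\<close>, and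
  that \<open>B\<close> is the matrix of the permutation \<open>i \<mapsto> j\<close>.  The intervals of the orbit of the first index,
  moved end to end, fill up an interval whose length is a multiple of \<open>T\<close>; by disjointness this length
  is \<open>T\<close> and no interval is left over.
\<close>

section \<open>Calculus in \<open>L\<^sup>2(\<Omega>)\<close>\<close>

lemma borel_measurable_cnj [measurable (raw)]:
  "f \<in> borel_measurable M \<Longrightarrow> (\<lambda>x. cnj (f x)) \<in> borel_measurable M"
  by (rule borel_measurable_continuous_on[OF continuous_on_cnj[OF continuous_on_id]])

lemma cmod_add_sq_le: "(cmod (a + b))\<^sup>2 \<le> 2 * (cmod a)\<^sup>2 + 2 * (cmod b)\<^sup>2"
proof -
  have "(cmod (a + b))\<^sup>2 + (cmod (a - b))\<^sup>2 = 2 * (cmod a)\<^sup>2 + 2 * (cmod b)\<^sup>2"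
    unfolding cmod_power2 by (simp add: power2_eq_square algebra_simps)
  then show ?thesis using zero_le_power2[of "cmod (a - b)"] by linarith
qed

lemma L2_add:
  assumes "f \<in> L2 \<Omega>" "g \<in> L2 \<Omega>"
  shows "(\<lambda>x. f x + g x) \<in> L2 \<Omega>"
proof -
  have [measurable]: "f \<in> borel_measurable (lebesgue_on \<Omega>)" "g \<in> borel_measurable (lebesgue_on \<Omega>)"
    using assms by (auto simp: L2_def)
  have "integrable (lebesgue_on \<Omega>) (\<lambda>x. 2 * (cmod (f x))\<^sup>2 + 2 * (cmod (g x))\<^sup>2)"
    using assms by (auto simp: L2_def)
  then have "integrable (lebesgue_on \<Omega>) (\<lambda>x. (cmod (f x + g x))\<^sup>2)"
    by (rule Bochner_Integration.integrable_bound) (use cmod_add_sq_le in auto)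
  then show ?thesis by (auto simp: L2_def)
qed

lemma L2_scale: "f \<in> L2 \<Omega> \<Longrightarrow> (\<lambda>x. c * f x) \<in> L2 \<Omega>"
  by (auto simp: L2_def norm_mult power_mult_distrib)

lemma L2_zero: "(\<lambda>x. 0) \<in> L2 \<Omega>"
  by (auto simp: L2_def)

lemma L2_comb: "f \<in> L2 \<Omega> \<Longrightarrow> g \<in> L2 \<Omega> \<Longrightarrow> (\<lambda>x. a * f x + b * g x) \<in> L2 \<Omega>"
  by (intro L2_add L2_scale)

lemma L2_diff: "f \<in> L2 \<Omega> \<Longrightarrow> g \<in> L2 \<Omega> \<Longrightarrow> (\<lambda>x. f x - g x) \<in> L2 \<Omega>"
  using L2_comb[of f \<Omega> g 1 "-1"] by simp

lemma L2_sum: "(\<And>i. i \<in> I \<Longrightarrow> f i \<in> L2 \<Omega>) \<Longrightarrow> (\<lambda>x. \<Sum>i\<in>I. f i x) \<in> L2 \<Omega>"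
  by (induction I rule: infinite_finite_induct) (auto intro: L2_zero L2_add)

section \<open>Sesquilinearity and definiteness of the inner product\<close>

lemma L2_inner_integrable:
  assumes "f \<in> L2 \<Omega>" "g \<in> L2 \<Omega>"
  shows "integrable (lebesgue_on \<Omega>) (\<lambda>x. f x * cnj (g x))"
proof -
  have [measurable]: "f \<in> borel_measurable (lebesgue_on \<Omega>)" "g \<in> borel_measurable (lebesgue_on \<Omega>)"
    using assms by (auto simp: L2_def)
  have *: "integrable (lebesgue_on \<Omega>) (\<lambda>x. (cmod (f x))\<^sup>2 + (cmod (g x))\<^sup>2)"
    using assms by (auto simp: L2_def)
  have "cmod a * cmod b \<le> (cmod a)\<^sup>2 + (cmod b)\<^sup>2" for a b :: complex
    using sum_squares_bound[of "cmod a" "cmod b"] mult_nonneg_nonneg[OF norm_ge_zero norm_ge_zero, of a b] by linarith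
  with * show ?thesis
    by (intro Bochner_Integration.integrable_bound[OF *]) (auto simp: norm_mult)
qed

lemma L2_inner_add:
  "f \<in> L2 \<Omega> \<Longrightarrow> g \<in> L2 \<Omega> \<Longrightarrow> h \<in> L2 \<Omega> \<Longrightarrow>
   L2_inner \<Omega> (\<lambda>x. f x + g x) h = L2_inner \<Omega> f h + L2_inner \<Omega> g h"
  unfolding L2_inner_def
  by (subst Bochner_Integration.integral_add[symmetric])
     (auto intro: L2_inner_integrable simp: algebra_simps)

lemma L2_inner_scale: "L2_inner \<Omega> (\<lambda>x. c * f x) h = c * L2_inner \<Omega> f h"
  unfolding L2_inner_def by (simp add: mult.assoc)

lemma L2_inner_cnj: "L2_inner \<Omega> g f = cnj (L2_inner \<Omega> f g)"
proof -
  have "L2_inner \<Omega> g f = integral\<^sup>L (lebesgue_on \<Omega>) (\<lambda>x. cnj (f x * cnj (g x)))"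
    by (simp add: L2_inner_def mult.commute)
  then show ?thesis by (simp only: Bochner_Integration.integral_cnj L2_inner_def)
qed

lemma L2_inner_add_right:
  "f \<in> L2 \<Omega> \<Longrightarrow> g \<in> L2 \<Omega> \<Longrightarrow> h \<in> L2 \<Omega> \<Longrightarrow>
   L2_inner \<Omega> h (\<lambda>x. f x + g x) = L2_inner \<Omega> h f + L2_inner \<Omega> h g"
  using L2_inner_add[of f \<Omega> g h] by (metis L2_inner_cnj complex_cnj_add)

lemma L2_inner_scale_right: "L2_inner \<Omega> h (\<lambda>x. c * f x) = cnj c * L2_inner \<Omega> h f"
  using L2_inner_scale[of \<Omega> c f h] by (metis L2_inner_cnj complex_cnj_mult)

lemma L2_inner_comb:
  "f \<in> L2 \<Omega> \<Longrightarrow> g \<in> L2 \<Omega> \<Longrightarrow> h \<in> L2 \<Omega> \<Longrightarrow>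
   L2_inner \<Omega> (\<lambda>x. a * f x + b * g x) h = a * L2_inner \<Omega> f h + b * L2_inner \<Omega> g h"
  by (simp add: L2_inner_add L2_scale L2_inner_scale)

lemma L2_inner_comb_right:
  "f \<in> L2 \<Omega> \<Longrightarrow> g \<in> L2 \<Omega> \<Longrightarrow> h \<in> L2 \<Omega> \<Longrightarrow>
   L2_inner \<Omega> h (\<lambda>x. a * f x + b * g x) = cnj a * L2_inner \<Omega> h f + cnj b * L2_inner \<Omega> h g"
  by (simp add: L2_inner_add_right L2_scale L2_inner_scale_right)

lemma L2_inner_diff:
  "f \<in> L2 \<Omega> \<Longrightarrow> g \<in> L2 \<Omega> \<Longrightarrow> h \<in> L2 \<Omega> \<Longrightarrow>
   L2_inner \<Omega> (\<lambda>x. f x - g x) h = L2_inner \<Omega> f h - L2_inner \<Omega> g h"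
  using L2_inner_comb[of f \<Omega> g h 1 "-1"] by simp

lemma L2_inner_diff_right:
  "f \<in> L2 \<Omega> \<Longrightarrow> g \<in> L2 \<Omega> \<Longrightarrow> h \<in> L2 \<Omega> \<Longrightarrow>
   L2_inner \<Omega> h (\<lambda>x. f x - g x) = L2_inner \<Omega> h f - L2_inner \<Omega> h g"
  using L2_inner_comb_right[of f \<Omega> g h 1 "-1"] by simp

lemma L2_inner_zero [simp]: "L2_inner \<Omega> (\<lambda>x. 0) h = 0" "L2_inner \<Omega> h (\<lambda>x. 0) = 0"
  by (auto simp: L2_inner_def)

lemma L2_inner_sum:
  assumes "\<And>i. i \<in> I \<Longrightarrow> f i \<in> L2 \<Omega>" "h \<in> L2 \<Omega>"
  shows "L2_inner \<Omega> (\<lambda>x. \<Sum>i\<in>I. c i * f i x) h = (\<Sum>i\<in>I. c i * L2_inner \<Omega> (f i) h)"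
  using assms
  by (induction I rule: infinite_finite_induct) (simp_all add: L2_inner_add L2_scale L2_sum L2_inner_scale)

lemma L2_inner_sum_right:
  assumes "\<And>i. i \<in> I \<Longrightarrow> f i \<in> L2 \<Omega>" "h \<in> L2 \<Omega>"
  shows "L2_inner \<Omega> h (\<lambda>x. \<Sum>i\<in>I. c i * f i x) = (\<Sum>i\<in>I. cnj (c i) * L2_inner \<Omega> h (f i))"
  using assms
  by (induction I rule: infinite_finite_induct)
     (simp_all add: L2_inner_add_right L2_scale L2_sum L2_inner_scale_right)

lemma L2_inner_cong:
  assumes "f \<in> L2 \<Omega>" "f' \<in> L2 \<Omega>" "h \<in> L2 \<Omega>" "L2_eq \<Omega> f f'"
  shows "L2_inner \<Omega> f h = L2_inner \<Omega> f' h"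
proof -
  have [measurable]: "f \<in> borel_measurable (lebesgue_on \<Omega>)" "f' \<in> borel_measurable (lebesgue_on \<Omega>)"
     "h \<in> borel_measurable (lebesgue_on \<Omega>)"
    using assms by (auto simp: L2_def)
  show ?thesis unfolding L2_inner_def
    by (rule integral_cong_AE) (use assms(4) in auto)
qed

lemma L2_inner_cong_right:
  assumes "f \<in> L2 \<Omega>" "f' \<in> L2 \<Omega>" "h \<in> L2 \<Omega>" "L2_eq \<Omega> f f'"
  shows "L2_inner \<Omega> h f = L2_inner \<Omega> h f'"
  using L2_inner_cong[OF assms] by (metis L2_inner_cnj)

lemma L2_inner_self: "L2_inner \<Omega> f f = of_real ((L2_norm \<Omega> f)\<^sup>2)"
proof -
  have "L2_inner \<Omega> f f = integral\<^sup>L (lebesgue_on \<Omega>) (\<lambda>x. of_real ((cmod (f x))\<^sup>2))"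
    by (simp add: L2_inner_def complex_norm_square[symmetric])
  then show ?thesis
    by (simp only: integral_complex_of_real L2_norm_def) simp
qed

lemma L2_norm_nonneg [simp]: "0 \<le> L2_norm \<Omega> f"
  by (simp add: L2_norm_def)

lemma L2_inner_self_zero:
  assumes "f \<in> L2 \<Omega>" "L2_inner \<Omega> f f = 0"
  shows "L2_eq \<Omega> f (\<lambda>x. 0)"
proof -
  have "L2_norm \<Omega> f = 0" using assms(2) by (simp add: L2_inner_self)
  then have "integral\<^sup>L (lebesgue_on \<Omega>) (\<lambda>x. (cmod (f x))\<^sup>2) = 0"
    by (simp add: L2_norm_def)
  then have "AE x in lebesgue_on \<Omega>. (cmod (f x))\<^sup>2 = 0"
    using assms(1) by (subst (asm) integral_nonneg_eq_0_iff_AE) (auto simp: L2_def)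
  then show ?thesis by simp
qed

text \<open>Testing against \<open>h = f - g\<close> makes the norm of the difference vanish.
  Operators known only through inner products are identified this way.\<close>

lemma L2_eqI:
  assumes "f \<in> L2 \<Omega>" "g \<in> L2 \<Omega>" "\<And>h. h \<in> L2 \<Omega> \<Longrightarrow> L2_inner \<Omega> f h = L2_inner \<Omega> g h"
  shows "L2_eq \<Omega> f g"
proof -
  have "L2_eq \<Omega> (\<lambda>x. f x - g x) (\<lambda>x. 0)"
    by (rule L2_inner_self_zero) (simp_all add: assms L2_diff L2_inner_diff)
  then show ?thesis by simp
qed

text \<open>The squared norms of \<open>s f + g\<close> and \<open>s f - g\<close> are nonnegative;
  expanding them and dividing by \<open>s\<close> gives this weighted bound, whose weight stays free
  for optimisation.\<close>

lemma Re_L2_inner_le: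
  assumes "f \<in> L2 \<Omega>" "g \<in> L2 \<Omega>" "s > 0"
  shows "2 * \<bar>Re (L2_inner \<Omega> f g)\<bar> \<le> s * (L2_norm \<Omega> f)\<^sup>2 + (L2_norm \<Omega> g)\<^sup>2 / s"
proof -
  have *: "0 \<le> s * (L2_norm \<Omega> f)\<^sup>2 + (L2_norm \<Omega> g)\<^sup>2 / s + c * (2 * Re (L2_inner \<Omega> f g))"
    if "c\<^sup>2 = 1" for c :: real
  proof -
    let ?u = "\<lambda>x. of_real s * f x + of_real c * g x"
    have "L2_inner \<Omega> ?u ?u = of_real (s\<^sup>2) * L2_inner \<Omega> f f + of_real (c\<^sup>2) * L2_inner \<Omega> g g
        + of_real (s * c) * (L2_inner \<Omega> f g + L2_inner \<Omega> g f)"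
      by (simp add: L2_inner_comb L2_inner_comb_right assms L2_comb algebra_simps power2_eq_square)
    also have "L2_inner \<Omega> f g + L2_inner \<Omega> g f = of_real (2 * Re (L2_inner \<Omega> f g))"
      by (metis L2_inner_cnj complex_add_cnj)
    finally have "complex_of_real ((L2_norm \<Omega> ?u)\<^sup>2) =
        of_real (s\<^sup>2 * (L2_norm \<Omega> f)\<^sup>2 + (L2_norm \<Omega> g)\<^sup>2 + s * (c * (2 * Re (L2_inner \<Omega> f g))))"
      by (simp add: L2_inner_self that mult.assoc del: of_real_power)
    then have "(L2_norm \<Omega> ?u)\<^sup>2 =
        s\<^sup>2 * (L2_norm \<Omega> f)\<^sup>2 + (L2_norm \<Omega> g)\<^sup>2 + s * (c * (2 * Re (L2_inner \<Omega> f g)))"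
      by (simp only: of_real_eq_iff)
    then have "0 \<le> s\<^sup>2 * (L2_norm \<Omega> f)\<^sup>2 + (L2_norm \<Omega> g)\<^sup>2 + s * (c * (2 * Re (L2_inner \<Omega> f g)))"
      using zero_le_power2[of "L2_norm \<Omega> ?u"] by simp
    also have "\<dots> = s * (s * (L2_norm \<Omega> f)\<^sup>2 + (L2_norm \<Omega> g)\<^sup>2 / s + c * (2 * Re (L2_inner \<Omega> f g)))"
      using assms(3) by (simp add: field_simps power2_eq_square)
    finally show ?thesis using assms(3) by (simp add: zero_le_mult_iff)
  qed
  show ?thesis using *[of 1] *[of "-1"] by simp
qed

lemma Re_L2_inner_Cauchy_Schwarz:
  assumes "f \<in> L2 \<Omega>" "g \<in> L2 \<Omega>"
  shows "\<bar>Re (L2_inner \<Omega> f g)\<bar> \<le> L2_norm \<Omega> f * L2_norm \<Omega> g"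
proof -
  define x where "x = \<bar>Re (L2_inner \<Omega> f g)\<bar>"
  define a where "a = L2_norm \<Omega> f"
  define b where "b = L2_norm \<Omega> g"
  have ab: "a \<ge> 0" "b \<ge> 0" "x \<ge> 0" by (auto simp: a_def b_def x_def)
  have *: "2 * x \<le> s * a\<^sup>2 + b\<^sup>2 / s" if "s > 0" for s
    using Re_L2_inner_le[OF assms that] by (simp add: x_def a_def b_def)
  have "x \<le> a * b"
  proof (cases "a > 0 \<and> b > 0")
    case True
    \<comment> \<open>At the optimal weight both terms on the right equal
      \<open>a * b\<close>.\<close>
    then show ?thesis using *[of "b / a"] by (simp add: power2_eq_square field_simps)
  next
    case False
    have "\<not> x > 0"
    proof
      assume "x > 0"
      show False
      proof (cases "a = 0")
        case True
        have "0 \<le> b\<^sup>2 / x" "0 \<le> b\<^sup>2" using \<open>x > 0\<close> by auto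
        then have "b\<^sup>2 / x + 1 > 0" by linarith
        \<comment> \<open>With \<open>a = 0\<close> a large weight shrinks the right-hand side; this
          one brings it down to at most \<open>x\<close>, contradicting
          \<open>x > 0\<close>.\<close>
        then have "2 * x \<le> b\<^sup>2 / (b\<^sup>2 / x + 1)" using *[of "b\<^sup>2 / x + 1"] True by simp
        also have "b\<^sup>2 / (b\<^sup>2 / x + 1) = x * b\<^sup>2 / (b\<^sup>2 + x)" using \<open>x > 0\<close> by (simp add: field_simps)
        also have "\<dots> \<le> x"
          using \<open>x > 0\<close> \<open>0 \<le> b\<^sup>2\<close> by (simp add: divide_le_eq add_nonneg_pos)
        finally show False using \<open>x > 0\<close> by simp
      next
        case False
        with \<open>\<not> (a > 0 \<and> b > 0)\<close> ab have "b = 0" by auto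
        \<comment> \<open>This weight turns the bound into \<open>2 * x \<le> x\<close>.\<close>
        then show False using *[of "x / a\<^sup>2"] False \<open>x > 0\<close> by simp
      qed
    qed
    then show ?thesis using ab by (smt (verit) mult_nonneg_nonneg)
  qed
  then show ?thesis by (simp add: x_def a_def b_def)
qed

section \<open>Projection-valued measures\<close>

lemma simple_integral_indicator_sum:
  assumes fin: "finite_measure N" and N [measurable_cong]: "sets N = sets borel"
    and s: "simple_function borel (s :: real \<Rightarrow> real)" and S: "S \<in> sets borel"
  shows "(\<integral>x. s x * indicator S x \<partial>N) = (\<Sum>c\<in>range s. c * measure N (s -` {c} \<inter> S))"
proof -
  interpret finite_measure N by fact
  have sp: "space N = UNIV" using sets_eq_imp_space_eq[OF N] by simp
  have fr: "finite (range s)" using s by (simp add: simple_function_def)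
  have meas: "s -` {c} \<inter> S \<in> sets N" for c
    using simple_functionD(2)[OF s, of "{c}"] S N by (simp add: sets.Int)
  have "s x * indicator S x = (\<Sum>c\<in>range s. c * indicator (s -` {c} \<inter> S) x)" for x
  proof -
    have "(\<Sum>c\<in>range s. c * indicator (s -` {c} \<inter> S) x) =
          (\<Sum>c\<in>range s. if c = s x then s x * indicator S x else 0)"
      by (intro sum.cong) (auto simp: indicator_def)
    also have "\<dots> = s x * indicator S x" using fr by (simp add: sum.delta)
    finally show ?thesis by simp
  qed
  then have "(\<integral>x. s x * indicator S x \<partial>N) = (\<integral>x. (\<Sum>c\<in>range s. c * indicator (s -` {c} \<inter> S) x) \<partial>N)"
    by simp
  also have "\<dots> = (\<Sum>c\<in>range s. \<integral>x. c * indicator (s -` {c} \<inter> S) x \<partial>N)"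
    using meas by (intro Bochner_Integration.integral_sum) (auto simp: less_top[symmetric])
  also have "\<dots> = (\<Sum>c\<in>range s. c * measure N (s -` {c} \<inter> S))"
    using meas by (simp add: sp)
  finally show ?thesis .
qed

section \<open>Form measures, simple operators and polarisation\<close>

locale spectral_pvm =
  fixes \<Omega> :: "real set" and E :: "real set \<Rightarrow> (real \<Rightarrow> complex) \<Rightarrow> (real \<Rightarrow> complex)"
  assumes pvm: "projection_valued_measure \<Omega> E"
begin

lemma proj: "S \<in> sets borel \<Longrightarrow> L2_projection \<Omega> (E S)"
  using pvm by (simp add: projection_valued_measure_def)

lemma E_L2: "S \<in> sets borel \<Longrightarrow> f \<in> L2 \<Omega> \<Longrightarrow> E S f \<in> L2 \<Omega>"
  using proj[of S] by (simp add: L2_projection_def L2_linear_def)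

lemma E_comb:
  "S \<in> sets borel \<Longrightarrow> f \<in> L2 \<Omega> \<Longrightarrow> g \<in> L2 \<Omega> \<Longrightarrow>
   L2_eq \<Omega> (E S (\<lambda>x. a * f x + b * g x)) (\<lambda>x. a * E S f x + b * E S g x)"
  using proj[of S] by (simp add: L2_projection_def L2_linear_def)

lemma E_adj:
  "S \<in> sets borel \<Longrightarrow> f \<in> L2 \<Omega> \<Longrightarrow> g \<in> L2 \<Omega> \<Longrightarrow> L2_inner \<Omega> (E S f) g = L2_inner \<Omega> f (E S g)"
  using proj[of S] by (simp add: L2_projection_def)

lemma E_UNIV: "f \<in> L2 \<Omega> \<Longrightarrow> L2_eq \<Omega> (E UNIV f) f"
  using pvm by (simp add: projection_valued_measure_def)

lemma E_empty: "f \<in> L2 \<Omega> \<Longrightarrow> L2_eq \<Omega> (E {} f) (\<lambda>x. 0)"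
  using pvm by (simp add: projection_valued_measure_def)

text \<open>Moving \<open>E T\<close> across by self-adjointness leaves the product
  \<open>E T (E S f)\<close>, which the projection-valued measure identifies with
  \<open>E (T \<inter> S) f\<close>.\<close>

lemma E_Int:
  assumes "S \<in> sets borel" "T \<in> sets borel" "f \<in> L2 \<Omega>" "g \<in> L2 \<Omega>"
  shows "L2_inner \<Omega> (E S f) (E T g) = L2_inner \<Omega> (E (T \<inter> S) f) g"
proof -
  have "L2_inner \<Omega> (E S f) (E T g) = L2_inner \<Omega> (E T (E S f)) g"
    using assms by (simp add: E_adj E_L2)
  also have "\<dots> = L2_inner \<Omega> (E (T \<inter> S) f) g"
  proof (rule L2_inner_cong[symmetric])
    show "L2_eq \<Omega> (E (T \<inter> S) f) (E T (E S f))"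
      using pvm assms by (simp add: projection_valued_measure_def)
  qed (use assms in \<open>auto intro: E_L2\<close>)
  finally show ?thesis .
qed

text \<open>The case \<open>S = T\<close> of \<open>E_Int\<close>: the form is real and nonnegative,
  so \<open>Re\<close> and \<open>ennreal\<close> in the form measure lose no information.\<close>

lemma E_form:
  "S \<in> sets borel \<Longrightarrow> f \<in> L2 \<Omega> \<Longrightarrow> L2_inner \<Omega> (E S f) f = of_real ((L2_norm \<Omega> (E S f))\<^sup>2)"
  using E_Int[of S S f f] by (simp add: L2_inner_self)

text \<open>Norm convergence of the partial sums \<open>E (A i) f\<close> passes to the inner
  products with \<open>f\<close> by Cauchy-Schwarz.\<close>

lemma E_form_sums:
  fixes A :: "nat \<Rightarrow> real set"
  assumes "range A \<subseteq> sets borel" "disjoint_family A" "f \<in> L2 \<Omega>"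
  shows "(\<lambda>i. Re (L2_inner \<Omega> (E (A i) f) f)) sums Re (L2_inner \<Omega> (E (\<Union>i. A i) f) f)"
proof -
  have A: "A i \<in> sets borel" for i using assms by auto
  then have UA: "(\<Union>i. A i) \<in> sets borel" by auto
  define w where "w N = (\<lambda>x. E (\<Union>i. A i) f x - (\<Sum>i<N. 1 * E (A i) f x))" for N
  have sL2: "(\<lambda>x. \<Sum>i<N. 1 * E (A i) f x) \<in> L2 \<Omega>" for N :: nat
    by (intro L2_sum L2_scale E_L2 A assms)
  then have wL2: "w N \<in> L2 \<Omega>" for N
    unfolding w_def by (intro L2_diff E_L2 UA assms)
  have "(\<lambda>N. L2_norm \<Omega> (w N)) \<longlonglongrightarrow> 0"
    using pvm assms by (simp add: projection_valued_measure_def w_def)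
  then have "(\<lambda>N. L2_norm \<Omega> (w N) * L2_norm \<Omega> f) \<longlonglongrightarrow> 0"
    by (rule tendsto_mult_left_zero)
  then have "(\<lambda>N. Re (L2_inner \<Omega> (w N) f)) \<longlonglongrightarrow> 0"
    by (rule Lim_null_comparison[rotated])
       (use Re_L2_inner_Cauchy_Schwarz[OF wL2 assms(3)] in auto)
  moreover have "Re (L2_inner \<Omega> (w N) f) = Re (L2_inner \<Omega> (E (\<Union>i. A i) f) f) - (\<Sum>i<N. Re (L2_inner \<Omega> (E (A i) f) f))" for N
    unfolding w_def using L2_inner_sum[of "{..<N}" "\<lambda>i. E (A i) f" \<Omega> f "\<lambda>_. 1"]
    by (subst L2_inner_diff) (use sL2 E_L2[OF UA] E_L2[OF A] assms in auto)
  ultimately have "(\<lambda>N. Re (L2_inner \<Omega> (E (\<Union>i. A i) f) f) - (\<Sum>i<N. Re (L2_inner \<Omega> (E (A i) f) f))) \<longlonglongrightarrow> 0"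
    by simp
  from tendsto_diff[OF tendsto_const[of "Re (L2_inner \<Omega> (E (\<Union>i. A i) f) f)"] this]
  show ?thesis by (simp add: sums_def)
qed

abbreviation form_measure :: "(real \<Rightarrow> complex) \<Rightarrow> real measure" where
  "form_measure \<equiv> spectral_form_measure \<Omega> E"

lemma sets_form_measure [measurable_cong, simp]: "sets (form_measure f) = sets borel"
  using sets.sigma_sets_eq[of "borel :: real measure"]
  by (simp add: spectral_form_measure_def sets_measure_of)

lemma space_form_measure [simp]: "space (form_measure f) = UNIV"
  by (simp add: spectral_form_measure_def space_measure_of)

text \<open>\<open>measure_of\<close> falls back to the zero measure unless the set function is a
  measure, so positivity and countable additivity have to be established before its values can be
  read off.\<close>

lemma emeasure_form_measure:
  assumes "f \<in> L2 \<Omega>" "S \<in> sets borel"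
  shows "emeasure (form_measure f) S = ennreal (Re (L2_inner \<Omega> (E S f) f))"
proof (rule emeasure_measure_of[OF spectral_form_measure_def])
  show "positive (sets (form_measure f)) (\<lambda>S. ennreal (Re (L2_inner \<Omega> (E S f) f)))"
    using L2_inner_cong[OF E_L2[of "{}"] L2_zero assms(1) E_empty] assms(1)
    by (simp add: positive_def)
  show "countably_additive (sets (form_measure f)) (\<lambda>S. ennreal (Re (L2_inner \<Omega> (E S f) f)))"
  proof (rule countably_additiveI)
    fix A :: "nat \<Rightarrow> real set"
    assume A: "range A \<subseteq> sets (form_measure f)" "disjoint_family A"
    then show "(\<Sum>i. ennreal (Re (L2_inner \<Omega> (E (A i) f) f))) = ennreal (Re (L2_inner \<Omega> (E (\<Union> (range A)) f) f))"
      by (intro suminf_ennreal_eq E_form_sums) (use assms(1) E_form in \<open>auto simp: range_subsetD\<close>)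
  qed
qed (use assms in auto)

lemma finite_form_measure: "f \<in> L2 \<Omega> \<Longrightarrow> finite_measure (form_measure f)"
  by (rule finite_measureI) (simp add: emeasure_form_measure)

lemma measure_form_measure:
  "f \<in> L2 \<Omega> \<Longrightarrow> S \<in> sets borel \<Longrightarrow> measure (form_measure f) S = Re (L2_inner \<Omega> (E S f) f)"
  by (simp add: measure_def emeasure_form_measure E_form)

text \<open>The operator \<open>s(E) = \<integral> s dE\<close> for a simple function \<open>s\<close>.\<close>

definition simple_op :: "(real \<Rightarrow> real) \<Rightarrow> (real \<Rightarrow> complex) \<Rightarrow> (real \<Rightarrow> complex)" where
  "simple_op s f = (\<lambda>x. \<Sum>c\<in>range s. of_real c * E (s -` {c}) f x)"

lemma simple_vimage: "simple_function borel (s :: real \<Rightarrow> real) \<Longrightarrow> s -` {c} \<in> sets borel"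
  using simple_functionD(2)[of borel s "{c}"] by simp

lemma simple_op_L2: "simple_function borel s \<Longrightarrow> f \<in> L2 \<Omega> \<Longrightarrow> simple_op s f \<in> L2 \<Omega>"
  unfolding simple_op_def by (intro L2_sum L2_scale E_L2 simple_vimage)

lemma simple_op_inner:
  "simple_function borel s \<Longrightarrow> f \<in> L2 \<Omega> \<Longrightarrow> g \<in> L2 \<Omega> \<Longrightarrow>
   L2_inner \<Omega> (simple_op s f) g = (\<Sum>c\<in>range s. of_real c * L2_inner \<Omega> (E (s -` {c}) f) g)"
  unfolding simple_op_def by (rule L2_inner_sum) (auto intro: E_L2 simple_vimage)

text \<open>Each level set contributes its value times the form on its intersection with
  \<open>S\<close>, by \<open>E_Int\<close>; these are the terms of the integral of \<open>s\<close>
  over \<open>S\<close>.\<close>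

lemma simple_op_inner_E:
  assumes s: "simple_function borel s" and f: "f \<in> L2 \<Omega>" and S: "S \<in> sets borel"
  shows "L2_inner \<Omega> (simple_op s f) (E S f) = of_real (\<integral>x. s x * indicator S x \<partial>form_measure f)"
proof -
  have "L2_inner \<Omega> (simple_op s f) (E S f) = (\<Sum>c\<in>range s. of_real c * L2_inner \<Omega> (E (s -` {c}) f) (E S f))"
    by (rule simple_op_inner) (auto intro: s f S E_L2)
  also have "\<dots> = (\<Sum>c\<in>range s. of_real (c * measure (form_measure f) (s -` {c} \<inter> S)))"
    using S simple_vimage[OF s] f
    by (intro sum.cong) (auto simp: E_Int measure_form_measure Int_commute E_form)
  also have "\<dots> = of_real (\<integral>x. s x * indicator S x \<partial>form_measure f)"
    by (subst simple_integral_indicator_sum[OF finite_form_measure[OF f] _ s S]) auto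
  finally show ?thesis .
qed

text \<open>The isometry of the functional calculus, for simple functions. It later bounds the
  vectors \<open>simple_op (s i) f\<close> uniformly in \<open>i\<close>.\<close>

lemma simple_op_norm:
  assumes s: "simple_function borel s" and f: "f \<in> L2 \<Omega>"
  shows "(L2_norm \<Omega> (simple_op s f))\<^sup>2 = (\<integral>x. (s x)\<^sup>2 \<partial>form_measure f)"
proof -
  interpret finite_measure "form_measure f" by (rule finite_form_measure[OF f])
  have fr: "finite (range s)" using s by (simp add: simple_function_def)
  have [measurable]: "s \<in> borel_measurable borel" using s by (rule borel_measurable_simple_function)
  have si: "integrable (form_measure f) (\<lambda>x. s x * indicator (s -` {c}) x)" for c
  proof (rule integrable_const_bound[where B = "\<bar>c\<bar>"])
    show "(\<lambda>x. s x * indicat_real (s -` {c}) x) \<in> borel_measurable (form_measure f)"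
      using simple_vimage[OF s, of c] by measurable
  qed (auto simp: indicator_def)
  have "L2_inner \<Omega> (simple_op s f) (simple_op s f)
      = (\<Sum>c\<in>range s. cnj (of_real c) * L2_inner \<Omega> (simple_op s f) (E (s -` {c}) f))"
    unfolding simple_op_def[of s f, abs_def]
    apply (subst L2_inner_sum_right)
    subgoal by (auto intro: E_L2 f simple_vimage[OF s])
    subgoal using simple_op_L2[OF s f] by (simp add: simple_op_def)
    by (simp add: simple_op_def)
  also have "\<dots> = of_real (\<Sum>c\<in>range s. c * (\<integral>x. s x * indicator (s -` {c}) x \<partial>form_measure f))"
    by (simp add: simple_op_inner_E s f simple_vimage)
  also have "(\<Sum>c\<in>range s. c * (\<integral>x. s x * indicator (s -` {c}) x \<partial>form_measure f))
     = (\<integral>x. (\<Sum>c\<in>range s. c * (s x * indicator (s -` {c}) x)) \<partial>form_measure f)"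
    using si by (subst Bochner_Integration.integral_sum) auto
  also have "(\<lambda>x. \<Sum>c\<in>range s. c * (s x * indicator (s -` {c}) x)) = (\<lambda>x. (s x)\<^sup>2)"
  proof
    fix x
    have "(\<Sum>c\<in>range s. c * (s x * indicator (s -` {c}) x)) = (\<Sum>c\<in>range s. if c = s x then (s x)\<^sup>2 else 0)"
      by (intro sum.cong) (auto simp: indicator_def power2_eq_square)
    then show "(\<Sum>c\<in>range s. c * (s x * indicator (s -` {c}) x)) = (s x)\<^sup>2"
      using fr by (simp add: sum.delta)
  qed
  finally show ?thesis
    by (simp only: L2_inner_self of_real_eq_iff)
qed

text \<open>Form measures see only the diagonal of the form. Expanding at \<open>u + c v\<close>,
  the terms even in \<open>c\<close> cancel between \<open>c = 1\<close> and \<open>c = -1\<close>,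
  and the cross term remains.\<close>

lemma E_polarisation:
  assumes S: "S \<in> sets borel" and u: "u \<in> L2 \<Omega>" and v: "v \<in> L2 \<Omega>"
  shows "4 * Re (L2_inner \<Omega> (E S u) v) =
    measure (form_measure (\<lambda>x. u x + v x)) S - measure (form_measure (\<lambda>x. u x - v x)) S"
proof -
  have *: "measure (form_measure (\<lambda>x. 1 * u x + of_real c * v x)) S =
      Re (L2_inner \<Omega> (E S u) u) + c\<^sup>2 * Re (L2_inner \<Omega> (E S v) v) + 2 * c * Re (L2_inner \<Omega> (E S u) v)"
    for c :: real
  proof -
    let ?w = "\<lambda>x. 1 * u x + of_real c * v x"
    have w: "?w \<in> L2 \<Omega>" by (intro L2_comb u v)
    have "L2_inner \<Omega> (E S ?w) ?w = L2_inner \<Omega> (\<lambda>x. 1 * E S u x + of_real c * E S v x) ?w"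
      by (rule L2_inner_cong[OF _ _ _ E_comb]) (intro S u v w E_L2 L2_comb)+
    also have "\<dots> = L2_inner \<Omega> (E S u) u + of_real (c\<^sup>2) * L2_inner \<Omega> (E S v) v
        + of_real c * (L2_inner \<Omega> (E S u) v + L2_inner \<Omega> (E S v) u)"
      unfolding L2_inner_comb[OF E_L2[OF S u] E_L2[OF S v] w] L2_inner_comb_right[OF u v E_L2[OF S u]]
        L2_inner_comb_right[OF u v E_L2[OF S v]]
      by (simp add: algebra_simps power2_eq_square)
    also have "L2_inner \<Omega> (E S v) u = cnj (L2_inner \<Omega> (E S u) v)"
      using E_adj[OF S u v] L2_inner_cnj[of \<Omega> "E S v" u] by simp
    finally show ?thesis
      using measure_form_measure[OF w S] by simp
  qed
  show ?thesis using *[of 1] *[of "-1"] by simp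
qed

lemma simple_op_polarisation:
  assumes s: "simple_function borel s" and u: "u \<in> L2 \<Omega>" and v: "v \<in> L2 \<Omega>"
  shows "4 * Re (L2_inner \<Omega> (simple_op s u) v) =
    (\<integral>x. s x \<partial>form_measure (\<lambda>x. u x + v x)) - (\<integral>x. s x \<partial>form_measure (\<lambda>x. u x - v x))"
proof -
  have int: "(\<integral>x. s x \<partial>form_measure w) = (\<Sum>c\<in>range s. c * measure (form_measure w) (s -` {c}))"
    if "w \<in> L2 \<Omega>" for w
    using simple_integral_indicator_sum[OF finite_form_measure[OF that] _ s, of UNIV] by simp
  have "4 * Re (L2_inner \<Omega> (simple_op s u) v) =
     (\<Sum>c\<in>range s. c * (4 * Re (L2_inner \<Omega> (E (s -` {c}) u) v)))"
    by (simp add: simple_op_inner[OF s u v] sum_distrib_left algebra_simps)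
  also have "\<dots> = (\<Sum>c\<in>range s. c * measure (form_measure (\<lambda>x. u x + v x)) (s -` {c}))
     - (\<Sum>c\<in>range s. c * measure (form_measure (\<lambda>x. u x - v x)) (s -` {c}))"
    unfolding E_polarisation[OF simple_vimage[OF s] u v]
    by (simp add: sum_subtractf right_diff_distrib)
  finally show ?thesis by (simp add: int L2_add L2_diff u v)
qed

text \<open>Dominated convergence with majorant \<open>2 * \<bar>g x\<bar>\<close> under both form
  measures. The function \<open>g\<close> may be unbounded: it is applied to the identity as well as
  to bounded functions.\<close>

lemma simple_op_polarisation_limit:
  assumes s: "\<And>i. simple_function borel (s i)" "\<And>x. (\<lambda>i. s i x) \<longlonglongrightarrow> g x"
      "\<And>i x. \<bar>s i x\<bar> \<le> 2 * \<bar>g x\<bar>"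
    and u: "u \<in> L2 \<Omega>" and v: "v \<in> L2 \<Omega>"
    and g: "integrable (form_measure (\<lambda>x. u x + v x)) g" "integrable (form_measure (\<lambda>x. u x - v x)) g"
  shows "(\<lambda>i. 4 * Re (L2_inner \<Omega> (simple_op (s i) u) v)) \<longlonglongrightarrow>
    (\<integral>x. g x \<partial>form_measure (\<lambda>x. u x + v x)) - (\<integral>x. g x \<partial>form_measure (\<lambda>x. u x - v x))"
proof -
  have m: "s i \<in> borel_measurable borel" for i
    using s(1) by (rule borel_measurable_simple_function)
  have lim: "(\<lambda>i. \<integral>x. s i x \<partial>form_measure w) \<longlonglongrightarrow> (\<integral>x. g x \<partial>form_measure w)"
    if "integrable (form_measure w) g" for w
    by (rule integral_dominated_convergence[where w = "\<lambda>x. 2 * \<bar>g x\<bar>"])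
       (use s m that borel_measurable_integrable[OF that] in auto)
  show ?thesis
    unfolding simple_op_polarisation[OF s(1) u v] by (intro tendsto_diff lim g)
qed

lemma form_measure_id_integrable:
  assumes f: "f \<in> L2 \<Omega>" and sq: "integrable (form_measure f) (\<lambda>x. x\<^sup>2)"
  shows "integrable (form_measure f) (\<lambda>x. x)"
proof -
  interpret finite_measure "form_measure f" by (rule finite_form_measure[OF f])
  show ?thesis
  proof (rule Bochner_Integration.integrable_bound[of _ "\<lambda>x. x\<^sup>2 + 1"])
    have "\<bar>x\<bar> \<le> x\<^sup>2 + 1" for x :: real
      using zero_le_power2[of "\<bar>x\<bar> - 1"] zero_le_power2[of x] by (simp add: power2_diff)
    then show "AE x in form_measure f. norm x \<le> norm (x\<^sup>2 + 1)" by (auto intro!: AE_I2)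
  qed (use sq in auto)
qed

text \<open>Only the quadratic form of the operator is known, and only on \<open>V\<close>.  For simple \<open>s\<^sub>i \<longlonglongrightarrow> id\<close> with
  \<open>\<bar>s\<^sub>i x\<bar> \<le> 2 \<bar>x\<bar>\<close> the vectors \<open>s\<^sub>i(E) f\<close> are bounded, because \<open>x\<^sup>2\<close> is integrable, so the limit
  \<open>Re \<langle>s\<^sub>i(E) f, v\<rangle> \<longlonglongrightarrow> \<xi> Re \<langle>f, v\<rangle>\<close> extends from the dense set \<open>V\<close> to \<open>v = E(S) f\<close>.\<close>

lemma form_measure_concentrated:
  assumes f: "f \<in> L2 \<Omega>"
    and V: "V \<subseteq> L2 \<Omega>"
    and dense: "\<And>h \<epsilon>. h \<in> L2 \<Omega> \<Longrightarrow> \<epsilon> > 0 \<Longrightarrow> \<exists>v\<in>V. L2_norm \<Omega> (\<lambda>x. h x - v x) < \<epsilon>"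
    and sq: "integrable (form_measure f) (\<lambda>x. x\<^sup>2)"
    and int: "\<And>v. v \<in> V \<Longrightarrow> integrable (form_measure (\<lambda>x. f x + v x)) (\<lambda>x. x)"
      "\<And>v. v \<in> V \<Longrightarrow> integrable (form_measure (\<lambda>x. f x - v x)) (\<lambda>x. x)"
    and form: "\<And>v. v \<in> V \<Longrightarrow> (\<integral>x. x \<partial>form_measure (\<lambda>x. f x + v x)) - (\<integral>x. x \<partial>form_measure (\<lambda>x. f x - v x))
        = 4 * \<xi> * Re (L2_inner \<Omega> f v)"
  shows "AE x in form_measure f. x = \<xi>"
proof -
  interpret finite_measure "form_measure f" by (rule finite_form_measure[OF f])
  \<comment> \<open>Approximation relative to the base point 0 supplies the majorant
    \<open>2 * \<bar>x\<bar>\<close>.\<close>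
  obtain s where s: "\<And>i. simple_function borel (s i)" "\<And>x. (\<lambda>i. s i x) \<longlonglongrightarrow> x"
      "\<And>i x. \<bar>s i x\<bar> \<le> 2 * \<bar>x :: real\<bar>"
    using borel_measurable_implies_sequence_metric[of "\<lambda>x :: real. x" borel 0] by auto
  have [measurable]: "s i \<in> borel_measurable borel" for i
    using s(1) by (rule borel_measurable_simple_function)
  have id: "integrable (form_measure f) (\<lambda>x. x)"
    by (rule form_measure_id_integrable[OF f sq])
  define C where "C = sqrt (\<integral>x. 4 * x\<^sup>2 \<partial>form_measure f)"
  have bound: "L2_norm \<Omega> (simple_op (s i) f) \<le> C" for i
  proof -
    have "(L2_norm \<Omega> (simple_op (s i) f))\<^sup>2 = (\<integral>x. (s i x)\<^sup>2 \<partial>form_measure f)"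
      by (rule simple_op_norm[OF s(1) f])
    also have "\<dots> \<le> (\<integral>x. 4 * x\<^sup>2 \<partial>form_measure f)"
    proof (rule integral_mono_AE')
      show "AE x in form_measure f. (s i x)\<^sup>2 \<le> 4 * x\<^sup>2"
        using power_mono[OF s(3) abs_ge_zero, of i _ 2] by (auto intro!: AE_I2 simp: power_mult_distrib)
    qed (use sq in auto)
    finally show ?thesis unfolding C_def by (intro real_le_rsqrt) simp
  qed
  \<comment> \<open>The signed measure with density \<open>x - \<xi>\<close> with respect to the
    form measure vanishes on every Borel set; testing it on the two half-lines at
    \<open>\<xi>\<close> then gives the claim.\<close>
  have main: "(\<integral>x. (x - \<xi>) * indicator S x \<partial>form_measure f) = 0" if S: "S \<in> sets borel" for S
  proof -
    define h where "h = E S f"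
    have h: "h \<in> L2 \<Omega>" unfolding h_def by (intro E_L2 S f)
    \<comment> \<open>\<open>A\<close> compares the limit for the test vector
      \<open>h = E S f\<close> with the value that the formula on \<open>V\<close> predicts.\<close>
    define A where "A = (\<integral>x. x * indicator S x \<partial>form_measure f) - \<xi> * Re (L2_inner \<Omega> f h)"
    have lim: "(\<lambda>i. Re (L2_inner \<Omega> (simple_op (s i) f) h)) \<longlonglongrightarrow> (\<integral>x. x * indicator S x \<partial>form_measure f)"
      unfolding h_def simple_op_inner_E[OF s(1) f S] Re_complex_of_real
    proof (rule integral_dominated_convergence[where w = "\<lambda>x. 2 * \<bar>x\<bar>"])
      show "AE x in form_measure f. (\<lambda>i. s i x * indicat_real S x) \<longlonglongrightarrow> x * indicat_real S x"
        by (intro AE_I2 tendsto_intros s)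
      show "integrable (form_measure f) (\<lambda>x. 2 * \<bar>x\<bar>)"
        by (intro integrable_mult_right integrable_abs id)
      show "(\<lambda>x. x * indicator S x) \<in> borel_measurable (form_measure f)"
        "(\<lambda>x. s i x * indicator S x) \<in> borel_measurable (form_measure f)" for i
        using S by measurable
      show "AE x in form_measure f. norm (s i x * indicator S x) \<le> 2 * \<bar>x\<bar>" for i
        using s(3) by (intro AE_I2) (simp add: indicator_def)
    qed
    \<comment> \<open>Replacing \<open>h\<close> by a nearby \<open>v\<close> in \<open>V\<close>
      costs at most \<open>C * \<epsilon>\<close> in the limit, uniformly in \<open>i\<close>, and
      at most \<open>\<bar>\<xi>\<bar> * L2_norm \<Omega> f * \<epsilon>\<close> in the predicted
      value.\<close>
    have A: "\<bar>A\<bar> \<le> \<epsilon> * (C + \<bar>\<xi>\<bar> * L2_norm \<Omega> f)" if "\<epsilon> > 0" for \<epsilon>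
    proof -
      obtain v where v: "v \<in> V" "L2_norm \<Omega> (\<lambda>x. h x - v x) < \<epsilon>" using dense[OF h \<open>\<epsilon> > 0\<close>] by blast
      have vL: "v \<in> L2 \<Omega>" using v V by auto
      have "(\<lambda>i. 4 * Re (L2_inner \<Omega> (simple_op (s i) f) v)) \<longlonglongrightarrow> 4 * \<xi> * Re (L2_inner \<Omega> f v)"
        using simple_op_polarisation_limit[OF s f vL int[OF v(1)]] form[OF v(1)] by simp
      then have "(\<lambda>i. Re (L2_inner \<Omega> (simple_op (s i) f) v)) \<longlonglongrightarrow> \<xi> * Re (L2_inner \<Omega> f v)"
        using tendsto_mult[OF tendsto_const[of "1/4 :: real"]] by fastforce
      then have *: "(\<lambda>i. \<bar>Re (L2_inner \<Omega> (simple_op (s i) f) h) - Re (L2_inner \<Omega> (simple_op (s i) f) v)\<bar>)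
          \<longlonglongrightarrow> \<bar>(\<integral>x. x * indicator S x \<partial>form_measure f) - \<xi> * Re (L2_inner \<Omega> f v)\<bar>"
        by (intro tendsto_intros lim)
      have "\<bar>Re (L2_inner \<Omega> (simple_op (s i) f) h) - Re (L2_inner \<Omega> (simple_op (s i) f) v)\<bar> \<le> C * \<epsilon>" for i
      proof -
        have "Re (L2_inner \<Omega> (simple_op (s i) f) h) - Re (L2_inner \<Omega> (simple_op (s i) f) v)
           = Re (L2_inner \<Omega> (simple_op (s i) f) (\<lambda>x. h x - v x))"
          by (simp add: L2_inner_diff_right h vL simple_op_L2 s f)
        also have "\<bar>\<dots>\<bar> \<le> L2_norm \<Omega> (simple_op (s i) f) * L2_norm \<Omega> (\<lambda>x. h x - v x)"
          by (intro Re_L2_inner_Cauchy_Schwarz simple_op_L2 s f L2_diff h vL)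
        also have "\<dots> \<le> C * \<epsilon>"
          by (rule mult_mono) (use bound v(2) order_trans[OF L2_norm_nonneg bound] in auto)
        finally show ?thesis .
      qed
      then have 1: "\<bar>(\<integral>x. x * indicator S x \<partial>form_measure f) - \<xi> * Re (L2_inner \<Omega> f v)\<bar> \<le> C * \<epsilon>"
        by (intro LIMSEQ_le_const2[OF *]) auto
      have "Re (L2_inner \<Omega> f h) - Re (L2_inner \<Omega> f v) = Re (L2_inner \<Omega> f (\<lambda>x. h x - v x))"
        by (simp add: L2_inner_diff_right h vL f)
      also have "\<bar>\<dots>\<bar> \<le> L2_norm \<Omega> f * L2_norm \<Omega> (\<lambda>x. h x - v x)"
        by (intro Re_L2_inner_Cauchy_Schwarz f L2_diff h vL)
      also have "\<dots> \<le> L2_norm \<Omega> f * \<epsilon>"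
        by (rule mult_left_mono[OF less_imp_le[OF v(2)] L2_norm_nonneg])
      finally have "\<bar>\<xi>\<bar> * \<bar>Re (L2_inner \<Omega> f h) - Re (L2_inner \<Omega> f v)\<bar> \<le> \<bar>\<xi>\<bar> * (L2_norm \<Omega> f * \<epsilon>)"
        by (intro mult_left_mono) auto
      then have 2: "\<bar>\<xi> * Re (L2_inner \<Omega> f h) - \<xi> * Re (L2_inner \<Omega> f v)\<bar> \<le> \<bar>\<xi>\<bar> * (L2_norm \<Omega> f * \<epsilon>)"
        by (simp only: abs_mult[symmetric] right_diff_distrib)
      have "\<epsilon> * (C + \<bar>\<xi>\<bar> * L2_norm \<Omega> f) = C * \<epsilon> + \<bar>\<xi>\<bar> * (L2_norm \<Omega> f * \<epsilon>)"
        by (simp add: algebra_simps)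
      with 1 2 show ?thesis unfolding A_def by linarith
    qed
    have "\<bar>A\<bar> \<le> 0"
    proof (rule field_le_epsilon)
      fix e :: real assume e: "e > 0"
      define K where "K = C + \<bar>\<xi>\<bar> * L2_norm \<Omega> f"
      have K: "K \<ge> 0" unfolding K_def C_def by (intro add_nonneg_nonneg mult_nonneg_nonneg) auto
      have "\<bar>A\<bar> \<le> e / (K + 1) * K"
        \<comment> \<open>Dividing by \<open>K + 1\<close> instead of \<open>K\<close> also covers
          \<open>K = 0\<close>.\<close>
        using A[of "e / (K + 1)"] e K
        by (simp add: K_def)
      also have "\<dots> \<le> e" using e K by (simp add: field_simps)
      finally show "\<bar>A\<bar> \<le> 0 + e" by simp
    qed
    then have "A = 0" by simp
    moreover have "Re (L2_inner \<Omega> f h) = measure (form_measure f) S"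
      using E_adj[OF S f f] by (simp add: measure_form_measure f S h_def)
    moreover have "(\<integral>x. (x - \<xi>) * indicator S x \<partial>form_measure f)
        = (\<integral>x. x * indicator S x - \<xi> * indicator S x \<partial>form_measure f)"
      by (simp add: left_diff_distrib)
    moreover have "\<dots> = (\<integral>x. x * indicator S x \<partial>form_measure f) - (\<integral>x. \<xi> * indicator S x \<partial>form_measure f)"
      using S by (intro Bochner_Integration.integral_diff integrable_real_mult_indicator id)
        (auto simp: less_top[symmetric])
    ultimately show ?thesis using S by (simp add: A_def)
  qed
  \<comment> \<open>The constant \<open>c\<close> is a sign that makes the integrand nonnegative, so
    that its zero integral forces it to vanish almost everywhere.\<close>
  have AE0: "AE x in form_measure f. (x - \<xi>) * indicator S x * c = 0"
    if S: "S \<in> sets borel" and nn: "\<And>x. (x - \<xi>) * indicator S x * c \<ge> 0" for S c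
  proof -
    have i: "integrable (form_measure f) (\<lambda>x. (x - \<xi>) * indicator S x * c)"
      using S id by (intro integrable_mult_left integrable_real_mult_indicator Bochner_Integration.integrable_diff) auto
    have "(\<integral>x. (x - \<xi>) * indicator S x * c \<partial>form_measure f) = 0"
      using main[OF S] by simp
    then show ?thesis
      by (subst (asm) integral_nonneg_eq_0_iff_AE[OF i]) (use nn in auto)
  qed
  have "AE x in form_measure f. (x - \<xi>) * indicator {\<xi><..} x * 1 = 0"
    by (rule AE0) (auto simp: indicator_def)
  moreover have "AE x in form_measure f. (x - \<xi>) * indicator {..<\<xi>} x * (-1) = 0"
    by (rule AE0) (auto simp: indicator_def)
  ultimately show ?thesis
    by eventually_elim (auto simp: indicator_def split: if_splits)
qed

section \<open>Functional calculus on a vector whose form measure is a point mass\<close>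

context
  fixes f \<xi>
  assumes f: "f \<in> L2 \<Omega>" and conc: "AE x in form_measure f. x = \<xi>"
begin

text \<open>The squared norm of \<open>E T f\<close> is the mass of \<open>T\<close>, so
  \<open>E T f\<close> vanishes if \<open>\<xi>\<close> is outside \<open>T\<close>. Otherwise the
  same holds for the complement, and additivity leaves \<open>E T f = f\<close> almost
  everywhere.\<close>

lemma E_concentrated:
  assumes T: "T \<in> sets borel" and h: "h \<in> L2 \<Omega>"
  shows "L2_inner \<Omega> (E T f) h = indicator T \<xi> * L2_inner \<Omega> f h"
proof -
  have zero: "L2_eq \<Omega> (E T f) (\<lambda>x. 0)" if T: "T \<in> sets borel" "\<xi> \<notin> T" for T
  proof (rule L2_inner_self_zero[OF E_L2[OF T(1) f]])
    have "AE x in form_measure f. x \<notin> T" using conc by eventually_elim (use T in auto)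
    then have "emeasure (form_measure f) T = 0"
      by (subst (asm) AE_iff_measurable[of T]) (use T in auto)
    then have "Re (L2_inner \<Omega> (E T f) f) = 0"
      using measure_form_measure[OF f T(1)] by (simp add: measure_def)
    then show "L2_inner \<Omega> (E T f) (E T f) = 0"
      using E_Int[OF T(1) T(1) f f] E_form[OF T(1) f] by simp
  qed
  show ?thesis
  proof (cases "\<xi> \<in> T")
    case False
    then show ?thesis
      using L2_inner_cong[OF E_L2[OF T f] L2_zero h zero[OF T]] by simp
  next
    case True
    have C: "- T \<in> sets borel" using T by auto
    have 0: "L2_inner \<Omega> g (E (- T) f) = 0" if "g \<in> L2 \<Omega>" for g
      using L2_inner_cong_right[OF E_L2[OF C f] L2_zero that zero[OF C]] True by simp
    have "L2_inner \<Omega> (E T f) f + L2_inner \<Omega> (E (- T) f) f = L2_inner \<Omega> f f"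
    proof -
      interpret finite_measure "form_measure f" by (rule finite_form_measure[OF f])
      have "measure (form_measure f) UNIV = measure (form_measure f) T + measure (form_measure f) (- T)"
        using T C by (subst finite_measure_Union[symmetric]) auto
      moreover have "L2_inner \<Omega> (E UNIV f) f = L2_inner \<Omega> f f"
        by (rule L2_inner_cong[OF E_L2[OF _ f] f f E_UNIV[OF f]]) auto
      ultimately have "Re (L2_inner \<Omega> f f) = Re (L2_inner \<Omega> (E T f) f + L2_inner \<Omega> (E (- T) f) f)"
        by (simp add: measure_form_measure f T C)
      then show ?thesis by (simp add: complex_eq_iff E_form f T C L2_inner_self)
    qed
    then have Tff: "L2_inner \<Omega> (E T f) f = L2_inner \<Omega> f f"
      using 0[OF f] L2_inner_cnj[of \<Omega> f "E (- T) f"] by simp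
    \<comment> \<open>All four terms of the expanded squared norm have absolute value equal to that
      of \<open>L2_inner \<Omega> f f\<close>, and they cancel.\<close>
    have "L2_eq \<Omega> (\<lambda>x. E T f x - f x) (\<lambda>x. 0)"
    proof (rule L2_inner_self_zero)
      show "L2_inner \<Omega> (\<lambda>x. E T f x - f x) (\<lambda>x. E T f x - f x) = 0"
        using E_Int[OF T T f f] E_adj[OF T f f] Tff
        by (simp add: L2_inner_diff L2_inner_diff_right E_L2 T f L2_diff)
    qed (intro L2_diff E_L2 T f)
    then have "L2_eq \<Omega> (E T f) f" by simp
    then show ?thesis using L2_inner_cong[OF E_L2[OF T f] f h] True by simp
  qed
qed

text \<open>Among the level sets of \<open>s\<close> only the one containing \<open>\<xi>\<close>
  survives.\<close>

lemma simple_op_concentrated: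
  assumes s: "simple_function borel s" and h: "h \<in> L2 \<Omega>"
  shows "L2_inner \<Omega> (simple_op s f) h = of_real (s \<xi>) * L2_inner \<Omega> f h"
proof -
  have fr: "finite (range s)" using s by (simp add: simple_function_def)
  have "L2_inner \<Omega> (simple_op s f) h = (\<Sum>c\<in>range s. if c = s \<xi> then of_real (s \<xi>) * L2_inner \<Omega> f h else 0)"
    unfolding simple_op_inner[OF s f h]
    by (intro sum.cong) (auto simp: E_concentrated[OF simple_vimage[OF s] h] indicator_def)
  then show ?thesis using fr by (simp add: sum.delta)
qed

text \<open>The form measures of \<open>f + h\<close> and \<open>f - h\<close> need not be point
  masses. Their polarised difference, however, is a limit of simple operators applied to
  \<open>f\<close>, and each of these evaluates at \<open>\<xi>\<close>.\<close>

lemma real_form_integral_concentrated: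
  fixes g :: "real \<Rightarrow> real"
  assumes g: "g \<in> borel_measurable borel" "\<And>x. \<bar>g x\<bar> \<le> K" and h: "h \<in> L2 \<Omega>"
  shows "(\<integral>x. g x \<partial>form_measure (\<lambda>x. f x + h x)) - (\<integral>x. g x \<partial>form_measure (\<lambda>x. f x - h x))
     = 4 * g \<xi> * Re (L2_inner \<Omega> f h)"
proof -
  obtain s where s: "\<And>i. simple_function borel (s i)" "\<And>x. (\<lambda>i. s i x) \<longlonglongrightarrow> g x"
      "\<And>i x. \<bar>s i x\<bar> \<le> 2 * \<bar>g x\<bar>"
    using borel_measurable_implies_sequence_metric[OF g(1), of 0] by auto
  have int: "integrable (form_measure w) g" if "w \<in> L2 \<Omega>" for w
    by (rule finite_measure.integrable_const_bound[OF finite_form_measure[OF that]])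
       (use g in auto)
  have lim1: "(\<lambda>i. 4 * Re (L2_inner \<Omega> (simple_op (s i) f) h)) \<longlonglongrightarrow>
     (\<integral>x. g x \<partial>form_measure (\<lambda>x. f x + h x)) - (\<integral>x. g x \<partial>form_measure (\<lambda>x. f x - h x))"
    by (rule simple_op_polarisation_limit[OF s f h int int]) (intro L2_add L2_diff f h)+
  have lim2: "(\<lambda>i. 4 * Re (L2_inner \<Omega> (simple_op (s i) f) h)) \<longlonglongrightarrow> 4 * (g \<xi> * Re (L2_inner \<Omega> f h))"
    by (simp add: simple_op_concentrated[OF s(1) h]) (intro tendsto_intros s(2))
  show ?thesis using LIMSEQ_unique[OF lim1 lim2] by simp
qed

lemma form_integral_concentrated:
  fixes \<phi> :: "real \<Rightarrow> complex"
  assumes \<phi>: "\<phi> \<in> borel_measurable borel" "\<And>x. cmod (\<phi> x) \<le> K" and h: "h \<in> L2 \<Omega>"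
  shows "(\<integral>x. \<phi> x \<partial>form_measure (\<lambda>x. f x + h x)) - (\<integral>x. \<phi> x \<partial>form_measure (\<lambda>x. f x - h x))
     = 4 * \<phi> \<xi> * of_real (Re (L2_inner \<Omega> f h))"
proof -
  have int: "integrable (form_measure w) \<phi>" if "w \<in> L2 \<Omega>" for w
    by (rule finite_measure.integrable_const_bound[OF finite_form_measure[OF that]])
       (use \<phi> in auto)
  have 1: "(\<lambda>x. Re (\<phi> x)) \<in> borel_measurable borel" "(\<lambda>x. Im (\<phi> x)) \<in> borel_measurable borel"
    using \<phi>(1) by measurable
  have 2: "\<bar>Re (\<phi> x)\<bar> \<le> K" "\<bar>Im (\<phi> x)\<bar> \<le> K" for x
    using order_trans[OF abs_Re_le_cmod \<phi>(2)] order_trans[OF abs_Im_le_cmod \<phi>(2)] by simp_all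
  show ?thesis
    using real_form_integral_concentrated[OF 1(1) 2(1) h] real_form_integral_concentrated[OF 1(2) 2(2) h]
      int[OF L2_add[OF f h]] int[OF L2_diff[OF f h]]
    by (simp add: complex_eq_iff)
qed

text \<open>Only the quadratic form of \<open>T\<close> is given. Polarising it with
  \<open>h\<close> yields the sum of \<open>L2_inner \<Omega> (T f) h\<close> and
  \<open>L2_inner \<Omega> (T h) f\<close>, polarising with \<open>\<i> * h\<close> their
  difference; together they determine both. The second formula serves to test \<open>T h\<close>
  against an eigenvector for arbitrary \<open>h\<close>.\<close>

lemma spectral_integral_concentrated:
  fixes \<phi> :: "real \<Rightarrow> complex"
  assumes \<phi>: "\<phi> \<in> borel_measurable borel" "\<And>x. cmod (\<phi> x) \<le> K"
    and T: "spectral_integral \<Omega> E \<phi> T" and h: "h \<in> L2 \<Omega>"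
  shows "L2_inner \<Omega> (T f) h = \<phi> \<xi> * L2_inner \<Omega> f h"
    and "L2_inner \<Omega> (T h) f = \<phi> \<xi> * L2_inner \<Omega> h f"
proof -
  have TL: "T u \<in> L2 \<Omega>" if "u \<in> L2 \<Omega>" for u
    using T that by (simp add: spectral_integral_def L2_linear_def)
  have Tlin: "L2_eq \<Omega> (T (\<lambda>x. a * u x + b * v x)) (\<lambda>x. a * T u x + b * T v x)"
    if "u \<in> L2 \<Omega>" "v \<in> L2 \<Omega>" for u v a b
    using T that by (simp add: spectral_integral_def L2_linear_def)
  have Tform: "L2_inner \<Omega> (T u) u = (\<integral>x. \<phi> x \<partial>form_measure u)" if "u \<in> L2 \<Omega>" for u
    using T that by (simp add: spectral_integral_def)
  have exp: "L2_inner \<Omega> (T (\<lambda>x. 1 * f x + c * v x)) (\<lambda>x. 1 * f x + c * v x)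
     = L2_inner \<Omega> (T f) f + cnj c * L2_inner \<Omega> (T f) v + c * L2_inner \<Omega> (T v) f + c * cnj c * L2_inner \<Omega> (T v) v"
    if v: "v \<in> L2 \<Omega>" for v c
  proof -
    let ?w = "\<lambda>x. 1 * f x + c * v x"
    have w: "?w \<in> L2 \<Omega>" by (intro L2_comb f v)
    have "L2_inner \<Omega> (T ?w) ?w = L2_inner \<Omega> (\<lambda>x. 1 * T f x + c * T v x) ?w"
      by (rule L2_inner_cong[OF TL[OF w] L2_comb[OF TL[OF f] TL[OF v]] w Tlin[OF f v]])
    also have "\<dots> = 1 * (cnj 1 * L2_inner \<Omega> (T f) f + cnj c * L2_inner \<Omega> (T f) v)
        + c * (cnj 1 * L2_inner \<Omega> (T v) f + cnj c * L2_inner \<Omega> (T v) v)"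
      unfolding L2_inner_comb[OF TL[OF f] TL[OF v] w] L2_inner_comb_right[OF f v TL[OF f]]
        L2_inner_comb_right[OF f v TL[OF v]] by simp
    finally show ?thesis by (simp add: algebra_simps)
  qed
  have key: "L2_inner \<Omega> (T f) v + L2_inner \<Omega> (T v) f = 2 * \<phi> \<xi> * of_real (Re (L2_inner \<Omega> f v))"
    if v: "v \<in> L2 \<Omega>" for v
  proof -
    let ?d = "L2_inner \<Omega> (T f) f + L2_inner \<Omega> (T v) v"
    let ?o = "L2_inner \<Omega> (T f) v + L2_inner \<Omega> (T v) f"
    have "?d + ?o = (\<integral>x. \<phi> x \<partial>form_measure (\<lambda>x. f x + v x))"
      using exp[OF v, of 1] Tform[OF L2_add[OF f v]] by (simp add: algebra_simps)
    moreover have "?d - ?o = (\<integral>x. \<phi> x \<partial>form_measure (\<lambda>x. f x - v x))"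
      using exp[OF v, of "-1"] Tform[OF L2_diff[OF f v]] by (simp add: algebra_simps)
    ultimately have "(?d + ?o) - (?d - ?o) = 4 * \<phi> \<xi> * of_real (Re (L2_inner \<Omega> f v))"
      using form_integral_concentrated[OF \<phi> v] by simp
    then have "2 * ?o = 2 * (2 * \<phi> \<xi> * of_real (Re (L2_inner \<Omega> f v)))" by simp
    then show ?thesis by (simp only: mult_cancel_left) simp
  qed
  \<comment> \<open>The summand \<open>0 * h x\<close> matches the two-term combinations in which
    linearity of \<open>T\<close> is stated. Against \<open>\<i> * h\<close> the real part of the
    inner product becomes the imaginary part.\<close>
  define v where "v = (\<lambda>x. 0 * h x + \<i> * h x)"
  have v: "v \<in> L2 \<Omega>" unfolding v_def by (intro L2_comb h)
  have "L2_inner \<Omega> (T v) f = \<i> * L2_inner \<Omega> (T h) f"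
    using L2_inner_cong[OF TL[OF v] _ f, of "\<lambda>x. 0 * T h x + \<i> * T h x"] Tlin[OF h h, of 0 \<i>]
      L2_comb[OF TL[OF h] TL[OF h], of 0 \<i>]
    by (simp add: v_def L2_inner_scale)
  moreover have "L2_inner \<Omega> u v = - \<i> * L2_inner \<Omega> u h" for u
    by (simp add: v_def L2_inner_scale_right)
  ultimately have "\<i> * L2_inner \<Omega> (T h) f - \<i> * L2_inner \<Omega> (T f) h = 2 * \<phi> \<xi> * of_real (Im (L2_inner \<Omega> f h))"
    using key[OF v] by simp
  then have "\<i> * (\<i> * L2_inner \<Omega> (T h) f - \<i> * L2_inner \<Omega> (T f) h) = \<i> * (2 * \<phi> \<xi> * of_real (Im (L2_inner \<Omega> f h)))"
    by simp
  then have d: "L2_inner \<Omega> (T f) h - L2_inner \<Omega> (T h) f = 2 * \<phi> \<xi> * (\<i> * of_real (Im (L2_inner \<Omega> f h)))"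
    by (simp add: algebra_simps)
  have fh: "of_real (Re (L2_inner \<Omega> f h)) + \<i> * of_real (Im (L2_inner \<Omega> f h)) = L2_inner \<Omega> f h"
    "of_real (Re (L2_inner \<Omega> f h)) - \<i> * of_real (Im (L2_inner \<Omega> f h)) = L2_inner \<Omega> h f"
    using L2_inner_cnj[of \<Omega> h f] by (simp_all add: complex_eq_iff)
  have "2 * L2_inner \<Omega> (T f) h = 2 * (\<phi> \<xi> * (of_real (Re (L2_inner \<Omega> f h)) + \<i> * of_real (Im (L2_inner \<Omega> f h))))"
    using key[OF h] d by (simp add: algebra_simps)
  then show "L2_inner \<Omega> (T f) h = \<phi> \<xi> * L2_inner \<Omega> f h" unfolding fh by simp
  have "2 * L2_inner \<Omega> (T h) f = 2 * (\<phi> \<xi> * (of_real (Re (L2_inner \<Omega> f h)) - \<i> * of_real (Im (L2_inner \<Omega> f h))))"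
    using key[OF h] d by (simp add: algebra_simps)
  then show "L2_inner \<Omega> (T h) f = \<phi> \<xi> * L2_inner \<Omega> h f" unfolding fh by simp
qed

end

end

section \<open>Exponentials on a finite union of intervals\<close>

lemma expo_cis: "expo \<xi> x = cis (2 * pi * \<xi> * x)"
  by (simp add: expo_def cis_conv_exp algebra_simps)

lemma expo_mult: "expo \<xi> x * expo \<eta> x = expo (\<xi> + \<eta>) x"
  by (simp add: expo_cis cis_mult algebra_simps)

lemma expo_nonzero [simp]: "expo \<xi> x \<noteq> 0"
  by (simp add: expo_cis)

lemma cmod_expo [simp]: "cmod (expo \<xi> x) = 1"
  by (simp add: expo_cis)

text \<open>Frequency and point play symmetric roles; the eigenvalue exp (2 pi i t \<xi>) of the
  group can therefore be written \<open>expo t \<xi>\<close>.\<close>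

lemma expo_commute: "expo \<xi> x = expo x \<xi>"
  by (simp add: expo_cis mult_ac)

lemma expo_has_vector_derivative:
  "(expo \<xi> has_vector_derivative (2 * pi * \<i> * \<xi> * expo \<xi> x)) (at x)"
proof -
  have "((\<lambda>x. exp (2 * of_real pi * \<i> * of_real \<xi> * of_real x)) has_vector_derivative
     (2 * pi * \<i> * \<xi> * exp (2 * of_real pi * \<i> * of_real \<xi> * of_real x))) (at x)"
    by (rule has_vector_derivative_real_field) (auto intro!: derivative_eq_intros)
  then show ?thesis by (simp add: expo_def[abs_def])
qed

lemma continuous_on_expo [continuous_intros]: "continuous_on S (expo \<xi>)"
  unfolding expo_def by (intro continuous_intros)

lemma borel_measurable_expo [measurable]: "expo \<xi> \<in> borel_measurable borel"
  by (intro borel_measurable_continuous_onI continuous_intros)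

lemma L2_bounded:
  assumes "\<Omega> \<in> lmeasurable" "f \<in> borel_measurable (lebesgue_on \<Omega>)" "\<And>x. cmod (f x) \<le> K"
  shows "f \<in> L2 \<Omega>"
proof -
  have [measurable]: "f \<in> borel_measurable (lebesgue_on \<Omega>)" by fact
  have "integrable (lebesgue_on \<Omega>) (\<lambda>x. (cmod (f x))\<^sup>2)"
    by (rule finite_measure.integrable_const_bound[OF finite_measure_lebesgue_on[OF assms(1)], of _ "K\<^sup>2"])
       (use assms(3) in \<open>auto intro!: AE_I2 power_mono\<close>)
  then show ?thesis using assms(2) by (simp add: L2_def)
qed

lemma expo_L2: "\<Omega> \<in> lmeasurable \<Longrightarrow> expo \<xi> \<in> L2 \<Omega>"
  by (rule L2_bounded[where K = 1])
     (auto intro!: continuous_imp_measurable_on_sets_lebesgue continuous_intros)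

lemma expo_inner_self: "\<Omega> \<in> lmeasurable \<Longrightarrow> L2_inner \<Omega> (expo \<xi>) (expo \<xi>) = of_real (measure lebesgue \<Omega>)"
  by (simp add: L2_inner_def complex_norm_square[symmetric] measure_restrict_space fmeasurableD scaleR_conv_of_real)

lemma expo_inner: "L2_inner \<Omega> (expo \<xi>) (expo \<eta>) = integral\<^sup>L (lebesgue_on \<Omega>) (expo (\<xi> - \<eta>))"
proof -
  have "expo \<xi> x * cnj (expo \<eta> x) = expo (\<xi> - \<eta>) x" for x
    by (simp add: expo_cis cis_cnj cis_mult algebra_simps)
  then show ?thesis by (simp add: L2_inner_def)
qed

section \<open>Trigonometric polynomials\<close>

definition trig_poly :: "real set \<Rightarrow> (real \<Rightarrow> complex) \<Rightarrow> real \<Rightarrow> complex" where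
  "trig_poly F c = (\<lambda>x. \<Sum>\<xi>\<in>F. c \<xi> * expo \<xi> x)"

lemma trig_poly_L2: "\<Omega> \<in> lmeasurable \<Longrightarrow> trig_poly F c \<in> L2 \<Omega>"
  unfolding trig_poly_def by (intro L2_sum L2_scale expo_L2)

lemma trig_poly_has_vector_derivative:
  "(trig_poly F c has_vector_derivative trig_poly F (\<lambda>\<xi>. c \<xi> * (2 * pi * \<i> * \<xi>)) x) (at x)"
  unfolding trig_poly_def
proof (rule has_vector_derivative_sum)
  fix \<xi>
  show "((\<lambda>x. c \<xi> * expo \<xi> x) has_vector_derivative c \<xi> * (2 * pi * \<i> * \<xi>) * expo \<xi> x) (at x)"
    using has_vector_derivative_mult_right[OF expo_has_vector_derivative[of \<xi> x], of "c \<xi>"]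
    by (simp add: mult.assoc)
qed

lemma isCont_trig_poly: "isCont (trig_poly F c) x"
  using trig_poly_has_vector_derivative has_vector_derivative_continuous by blast

lemma trig_poly_Lipschitz:
  "\<exists>K>0. \<forall>x y. cmod (trig_poly F c x - trig_poly F c y) \<le> K * \<bar>x - y\<bar>"
proof -
  define d where "d \<xi> = c \<xi> * (2 * pi * \<i> * \<xi>)" for \<xi>
  \<comment> \<open>The derivative is again a trigonometric polynomial, bounded by the sum of the
    moduli of its coefficients. The summand 1 keeps \<open>K\<close> positive, as the choice of
    \<open>\<delta>\<close> as \<open>\<epsilon> / K\<close> requires later.\<close>
  define K where "K = (\<Sum>\<xi>\<in>F. cmod (d \<xi>)) + 1"
  have "K > 0" unfolding K_def by (intro add_nonneg_pos sum_nonneg) auto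
  have b: "cmod (trig_poly F d x) \<le> K" for x
  proof -
    have "cmod (trig_poly F d x) \<le> (\<Sum>\<xi>\<in>F. cmod (d \<xi> * expo \<xi> x))"
      unfolding trig_poly_def by (rule norm_sum)
    then show ?thesis by (simp add: K_def norm_mult)
  qed
  have "cmod (trig_poly F c x - trig_poly F c y) \<le> K * norm (x - y)" for x y
  proof (rule differentiable_bound[where S = UNIV and f' = "\<lambda>x h. h *\<^sub>R trig_poly F d x"])
    show "(trig_poly F c has_derivative (\<lambda>h. h *\<^sub>R trig_poly F d x)) (at x within UNIV)" for x
      using trig_poly_has_vector_derivative[of F c x]
      by (simp add: has_vector_derivative_def d_def[abs_def])
    show "onorm (\<lambda>h. h *\<^sub>R trig_poly F d x) \<le> K" for x
    proof (rule onorm_bound)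
      show "norm (h *\<^sub>R trig_poly F d x) \<le> K * norm h" for h :: real
        using mult_left_mono[OF b abs_ge_zero, of h x] by (simp add: mult.commute)
    qed (use \<open>K > 0\<close> in auto)
  qed auto
  then show ?thesis using \<open>K > 0\<close> by auto
qed

lemma abs_continuous_trig_poly: "abs_continuous a b (trig_poly F c)"
  unfolding abs_continuous_def
proof (intro allI impI)
  fix \<epsilon> :: real assume "\<epsilon> > 0"
  obtain K where K: "K > 0" "\<And>x y. cmod (trig_poly F c x - trig_poly F c y) \<le> K * \<bar>x - y\<bar>"
    using trig_poly_Lipschitz by blast
  show "\<exists>\<delta>>0. \<forall>(N::nat) u v. (\<forall>i<N. a < u i \<and> u i \<le> v i \<and> v i < b) \<and>
        disjoint_family_on (\<lambda>i. {u i<..<v i}) {..<N} \<and> (\<Sum>i<N. v i - u i) < \<delta> \<longrightarrow>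
        (\<Sum>i<N. cmod (trig_poly F c (v i) - trig_poly F c (u i))) < \<epsilon>"
  proof (intro exI[of _ "\<epsilon> / K"] conjI allI impI)
    show "\<epsilon> / K > 0" using K \<open>\<epsilon> > 0\<close> by simp
    fix N :: nat and u v :: "nat \<Rightarrow> real"
    assume *: "(\<forall>i<N. a < u i \<and> u i \<le> v i \<and> v i < b) \<and>
        disjoint_family_on (\<lambda>i. {u i<..<v i}) {..<N} \<and> (\<Sum>i<N. v i - u i) < \<epsilon> / K"
    have "(\<Sum>i<N. cmod (trig_poly F c (v i) - trig_poly F c (u i))) \<le> (\<Sum>i<N. K * (v i - u i))"
      using * K(2) by (intro sum_mono) (metis abs_of_nonneg diff_ge_0_iff_ge lessThan_iff)
    also have "\<dots> = K * (\<Sum>i<N. v i - u i)" by (simp add: sum_distrib_left)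
    also have "\<dots> < \<epsilon>" using * K(1) by (simp add: field_simps)
    finally show "(\<Sum>i<N. cmod (trig_poly F c (v i) - trig_poly F c (u i))) < \<epsilon>" .
  qed
qed

lemma Lim_at_right_isCont: "isCont f a \<Longrightarrow> Lim (at_right (a :: real)) f = f a"
  by (rule tendsto_Lim) (auto simp: isCont_def filterlim_at_split)

lemma Lim_at_left_isCont: "isCont f a \<Longrightarrow> Lim (at_left (a :: real)) f = f a"
  by (rule tendsto_Lim) (auto simp: isCont_def filterlim_at_split)

lemma isCont_expo: "isCont (expo \<xi>) x"
  using continuous_on_expo[of UNIV \<xi>] by (simp add: continuous_on_eq_continuous_at)

section \<open>Ordered systems of intervals\<close>

locale interval_system =
  fixes n :: nat and \<alpha> \<beta> :: "nat \<Rightarrow> real"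
  assumes n_pos: "n \<ge> 1"
    and lt: "i < n \<Longrightarrow> \<alpha> i < \<beta> i"
    and gap: "Suc i < n \<Longrightarrow> \<beta> i < \<alpha> (Suc i)"
begin

abbreviation "\<Omega> \<equiv> interval_union n \<alpha> \<beta>"

lemma interval_order: "i < j \<Longrightarrow> j < n \<Longrightarrow> \<beta> i < \<alpha> j"
proof (induction j)
  case (Suc j)
  then show ?case
  proof (cases "i = j")
    case False
    then have "\<beta> i < \<alpha> j" "\<alpha> j < \<beta> j" "\<beta> j < \<alpha> (Suc j)"
      using Suc lt[of j] gap[of j] by auto
    then show ?thesis by linarith
  qed (use gap in auto)
qed simp

lemma interval_unique:
  assumes "i < n" "j < n" "\<alpha> i < x" "x < \<beta> i" "\<alpha> j < x" "x < \<beta> j"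
  shows "i = j"
  using interval_order[of i j] interval_order[of j i] assms by (cases i j rule: linorder_cases) auto

lemma in_Omega: "i < n \<Longrightarrow> \<alpha> i < x \<Longrightarrow> x < \<beta> i \<Longrightarrow> x \<in> \<Omega>"
  by (auto simp: interval_union_def)

lemma Omega_open: "open \<Omega>"
  by (auto simp: interval_union_def)

lemma Omega_bounded: "bounded \<Omega>"
  unfolding interval_union_def by (intro bounded_UN) (auto simp flip: box_real)

lemma Omega_lmeasurable: "\<Omega> \<in> lmeasurable"
  using Omega_bounded Omega_open by (simp add: lmeasurable_open)

lemma measure_Omega: "measure lebesgue \<Omega> = (\<Sum>i<n. \<beta> i - \<alpha> i)"
proof -
  have "measure lebesgue \<Omega> = (\<Sum>i<n. measure lebesgue {\<alpha> i<..<\<beta> i})"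
    unfolding interval_union_def
  proof (rule measure_finite_Union)
    show "disjoint_family_on (\<lambda>i. {\<alpha> i<..<\<beta> i}) {..<n}"
      unfolding disjoint_family_on_def using interval_unique by fastforce
  qed (use lt in \<open>auto simp: less_imp_le\<close>)
  then show ?thesis using lt by (simp add: less_imp_le)
qed

lemma measure_Omega_pos: "measure lebesgue \<Omega> > 0"
  unfolding measure_Omega using lt n_pos
  by (intro sum_pos) (auto intro: lessThan_empty_iff simp: lessThan_empty_iff)

end

section \<open>Completeness, boundary condition and the quadratic form of the operator\<close>

locale spectral_system = interval_system +
  fixes \<Lambda> :: "real set" and B :: "complex mat"
  assumes spectral: "spectral_with \<Omega> \<Lambda>"
    and B_carrier: "B \<in> carrier_mat n n"
    and B_vec: "\<forall>\<xi>\<in>\<Lambda>. B *\<^sub>v left_values n \<alpha> (expo \<xi>) = right_values n \<beta> (expo \<xi>)"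
begin

lemma expo_orth:
  "\<xi> \<in> \<Lambda> \<Longrightarrow> \<eta> \<in> \<Lambda> \<Longrightarrow> L2_inner \<Omega> (expo \<xi>) (expo \<eta>) = (if \<xi> = \<eta> then of_real (measure lebesgue \<Omega>) else 0)"
  using spectral expo_inner_self[OF Omega_lmeasurable] by (auto simp: spectral_with_def)

lemma trig_poly_dense:
  "f \<in> L2 \<Omega> \<Longrightarrow> \<epsilon> > 0 \<Longrightarrow> \<exists>F c. finite F \<and> F \<subseteq> \<Lambda> \<and> L2_norm \<Omega> (\<lambda>x. f x - trig_poly F c x) < \<epsilon>"
  using spectral by (simp add: spectral_with_def trig_poly_def)

lemma L2_norm_expo: "(L2_norm \<Omega> (expo \<xi>))\<^sup>2 = measure lebesgue \<Omega>"
  using expo_inner_self[OF Omega_lmeasurable, of \<xi>] by (simp only: L2_inner_self of_real_eq_iff)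

text \<open>Completeness implies maximality: if \<open>p\<close> approximates \<open>f\<close>
  within less than its norm, orthogonality gives that the squared norm of \<open>f\<close> is
  \<open>Re (L2_inner \<Omega> f (f - p))\<close>, which Cauchy-Schwarz makes strictly
  smaller.\<close>

lemma orthogonal_imp_zero:
  assumes f: "f \<in> L2 \<Omega>" and orth: "\<And>\<eta>. \<eta> \<in> \<Lambda> \<Longrightarrow> L2_inner \<Omega> f (expo \<eta>) = 0"
  shows "L2_norm \<Omega> f = 0"
proof (rule ccontr)
  assume "L2_norm \<Omega> f \<noteq> 0"
  then have pos: "L2_norm \<Omega> f > 0" using L2_norm_nonneg[of \<Omega> f] by linarith
  from trig_poly_dense[OF f pos] obtain F c
    where F: "F \<subseteq> \<Lambda>" "L2_norm \<Omega> (\<lambda>x. f x - trig_poly F c x) < L2_norm \<Omega> f"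
    by blast
  let ?d = "\<lambda>x. f x - trig_poly F c x"
  have "L2_inner \<Omega> f (trig_poly F c) = (\<Sum>\<eta>\<in>F. cnj (c \<eta>) * L2_inner \<Omega> f (expo \<eta>))"
    unfolding trig_poly_def by (intro L2_inner_sum_right expo_L2 Omega_lmeasurable f)
  also have "\<dots> = 0" using F(1) orth by (intro sum.neutral) auto
  finally have "(L2_norm \<Omega> f)\<^sup>2 = Re (L2_inner \<Omega> f ?d)"
    by (simp add: L2_inner_diff_right f trig_poly_L2 Omega_lmeasurable L2_inner_self)
  also have "\<dots> \<le> L2_norm \<Omega> f * L2_norm \<Omega> ?d"
    using Re_L2_inner_Cauchy_Schwarz[OF f L2_diff[OF f trig_poly_L2[OF Omega_lmeasurable]], of F c] by linarith
  also have "\<dots> < L2_norm \<Omega> f * L2_norm \<Omega> f"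
    using F(2) pos by (intro mult_strict_left_mono)
  finally show False by (simp add: power2_eq_square)
qed

lemma trig_poly_inner:
  assumes "finite F" "F \<subseteq> \<Lambda>"
  shows "L2_inner \<Omega> (trig_poly F a) (trig_poly F b) = of_real (measure lebesgue \<Omega>) * (\<Sum>\<xi>\<in>F. a \<xi> * cnj (b \<xi>))"
proof -
  have "L2_inner \<Omega> (trig_poly F a) (trig_poly F b) =
     (\<Sum>\<xi>\<in>F. a \<xi> * (\<Sum>\<eta>\<in>F. cnj (b \<eta>) * L2_inner \<Omega> (expo \<xi>) (expo \<eta>)))"
    using trig_poly_L2[OF Omega_lmeasurable, of F b] expo_L2[OF Omega_lmeasurable]
    unfolding trig_poly_def by (simp add: L2_inner_sum L2_inner_sum_right)
  also have "\<dots> = (\<Sum>\<xi>\<in>F. a \<xi> * (\<Sum>\<eta>\<in>F. if \<eta> = \<xi> then cnj (b \<xi>) * of_real (measure lebesgue \<Omega>) else 0))"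
    using assms(2) by (intro sum.cong refl arg_cong2[where f = "(*)"]) (auto simp: expo_orth subset_iff)
  also have "\<dots> = of_real (measure lebesgue \<Omega>) * (\<Sum>\<xi>\<in>F. a \<xi> * cnj (b \<xi>))"
    using assms(1) by (simp add: sum.delta sum_distrib_left mult_ac)
  finally show ?thesis .
qed

lemma B_expo:
  assumes "\<xi> \<in> \<Lambda>" "i < n"
  shows "(\<Sum>j<n. B $$ (i, j) * expo \<xi> (\<alpha> j)) = expo \<xi> (\<beta> i)"
proof -
  have "(B *\<^sub>v left_values n \<alpha> (expo \<xi>)) $ i = right_values n \<beta> (expo \<xi>) $ i"
    using B_vec assms by simp
  then show ?thesis using B_carrier assms(2)
    by (auto simp: left_values_def right_values_def Lim_at_right_isCont Lim_at_left_isCont isCont_expo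
        scalar_prod_def lessThan_atLeast0)
qed

text \<open>The boundary condition is linear and passes from the exponentials to their combinations.
  On this dense family the operator multiplies each coefficient by its frequency, so its form is
  explicit.\<close>

lemma trig_poly_D_op:
  assumes F: "finite F" "F \<subseteq> \<Lambda>"
  shows "(trig_poly F c, trig_poly F (\<lambda>\<xi>. c \<xi> * of_real \<xi>)) \<in> D_op n \<alpha> \<beta> B"
proof -
  have vd: "vector_derivative (trig_poly F c) (at x) = trig_poly F (\<lambda>\<xi>. c \<xi> * (2 * pi * \<i> * \<xi>)) x" for x
    by (rule vector_derivative_at[OF trig_poly_has_vector_derivative])
  have vd': "vector_derivative (trig_poly F c) (at x) / (2 * of_real pi * \<i>) = trig_poly F (\<lambda>\<xi>. c \<xi> * of_real \<xi>) x" for x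
    unfolding vd by (simp add: trig_poly_def sum_distrib_left) (simp add: sum_divide_distrib field_simps)
  have "B *\<^sub>v left_values n \<alpha> (trig_poly F c) = right_values n \<beta> (trig_poly F c)"
  proof (rule eq_vecI)
    fix i assume "i < dim_vec (right_values n \<beta> (trig_poly F c))"
    then have i: "i < n" by (simp add: right_values_def)
    have "(B *\<^sub>v left_values n \<alpha> (trig_poly F c)) $ i = (\<Sum>j<n. B $$ (i, j) * trig_poly F c (\<alpha> j))"
      using B_carrier i
      by (auto simp: left_values_def Lim_at_right_isCont isCont_trig_poly scalar_prod_def lessThan_atLeast0)
    also have "\<dots> = (\<Sum>j<n. \<Sum>\<xi>\<in>F. c \<xi> * (B $$ (i, j) * expo \<xi> (\<alpha> j)))"
      by (simp add: trig_poly_def sum_distrib_left mult_ac)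
    also have "\<dots> = (\<Sum>\<xi>\<in>F. c \<xi> * (\<Sum>j<n. B $$ (i, j) * expo \<xi> (\<alpha> j)))"
      by (subst sum.swap) (simp add: sum_distrib_left)
    also have "\<dots> = trig_poly F c (\<beta> i)"
      unfolding trig_poly_def using F i B_expo by (intro sum.cong) auto
    finally show "(B *\<^sub>v left_values n \<alpha> (trig_poly F c)) $ i = right_values n \<beta> (trig_poly F c) $ i"
      using i by (simp add: right_values_def Lim_at_left_isCont isCont_trig_poly)
  qed (use B_carrier in \<open>auto simp: right_values_def\<close>)
  then have "trig_poly F c \<in> D_space_B n \<alpha> \<beta> B"
    by (simp add: D_space_B_def D_space_def vd trig_poly_L2 Omega_lmeasurable abs_continuous_trig_poly)
  then show ?thesis
    unfolding D_op_def by (auto intro!: bexI[of _ "trig_poly F c"] simp: vd' trig_poly_L2 Omega_lmeasurable)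
qed

text \<open>\<open>spectral_measure_of\<close> ties \<open>E\<close> to the operator only through
  domain and quadratic form, so the eigenvector property has to be extracted from the form. On
  trigonometric polynomials it is diagonal in the frequencies, and polarisation with
  \<open>expo \<xi>\<close> picks out the factor \<open>\<xi>\<close>; this is the hypothesis of
  \<open>form_measure_concentrated\<close> for a dense set.\<close>

lemma expo_form_measure_concentrated:
  assumes E: "spectral_measure_of \<Omega> (D_op n \<alpha> \<beta> B) E" and \<xi>: "\<xi> \<in> \<Lambda>"
  shows "AE x in spectral_form_measure \<Omega> E (expo \<xi>). x = \<xi>"
proof -
  let ?L = "measure lebesgue \<Omega>"
  interpret spectral_pvm \<Omega> E
    using E by unfold_locales (simp add: spectral_measure_of_def)
  have int: "integrable (form_measure (trig_poly F c)) (\<lambda>x. x\<^sup>2)" if "finite F" "F \<subseteq> \<Lambda>" for F c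
    using E trig_poly_D_op[OF that, of c] trig_poly_L2[OF Omega_lmeasurable, of F c]
    by (auto simp: spectral_measure_of_def Domain.simps)
  have form: "(\<integral>x. x \<partial>form_measure (trig_poly F c)) = ?L * (\<Sum>\<eta>\<in>F. \<eta> * (cmod (c \<eta>))\<^sup>2)"
    if "finite F" "F \<subseteq> \<Lambda>" for F c
  proof -
    have "of_real (\<integral>x. x \<partial>form_measure (trig_poly F c)) =
        L2_inner \<Omega> (trig_poly F (\<lambda>\<eta>. c \<eta> * of_real \<eta>)) (trig_poly F c)"
      using E trig_poly_D_op[OF that, of c] by (auto simp: spectral_measure_of_def)
    also have "\<dots> = of_real (?L * (\<Sum>\<eta>\<in>F. \<eta> * (cmod (c \<eta>))\<^sup>2))"
    proof -
      have "c \<eta> * of_real \<eta> * cnj (c \<eta>) = of_real (\<eta> * (cmod (c \<eta>))\<^sup>2)" for \<eta>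
        by (simp only: of_real_mult complex_norm_square mult_ac)
      then show ?thesis by (simp only: trig_poly_inner[OF that] of_real_mult of_real_sum)
    qed
    finally show ?thesis by (simp only: of_real_eq_iff)
  qed
  define V where "V = {trig_poly F c | F c. finite F \<and> F \<subseteq> \<Lambda>}"
  \<comment> \<open>Adding \<open>\<xi>\<close> to \<open>F\<close> with coefficient 0 puts
    \<open>v\<close> and \<open>expo \<xi>\<close> over one index set.\<close>
  have V: "\<exists>F c. finite F \<and> F \<subseteq> \<Lambda> \<and> \<xi> \<in> F \<and> v = trig_poly F c" if v: "v \<in> V" for v
  proof -
    obtain F c where F: "finite F" "F \<subseteq> \<Lambda>" "v = trig_poly F c" using v by (auto simp: V_def)
    have "v = trig_poly (insert \<xi> F) (\<lambda>\<eta>. if \<eta> \<in> F then c \<eta> else 0)"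
      unfolding F(3) trig_poly_def by (rule ext, rule sum.mono_neutral_cong_left) (use F in auto)
    then show ?thesis using F \<xi> by (intro exI conjI) auto
  qed
  define \<delta> where "\<delta> \<eta> = (if \<eta> = \<xi> then 1 else 0 :: complex)" for \<eta>
  have expo: "expo \<xi> = trig_poly F \<delta>" if "finite F" "\<xi> \<in> F" for F
  proof
    fix x
    have "trig_poly F \<delta> x = (\<Sum>\<eta>\<in>F. if \<eta> = \<xi> then expo \<xi> x else 0)"
      unfolding trig_poly_def by (intro sum.cong) (auto simp: \<delta>_def)
    then show "expo \<xi> x = trig_poly F \<delta> x" using that by (simp add: sum.delta')
  qed
  have comb: "(\<lambda>x. expo \<xi> x + trig_poly F c x) = trig_poly F (\<lambda>\<eta>. \<delta> \<eta> + c \<eta>)"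
    "(\<lambda>x. expo \<xi> x - trig_poly F c x) = trig_poly F (\<lambda>\<eta>. \<delta> \<eta> - c \<eta>)"
    if "finite F" "\<xi> \<in> F" for F c
    unfolding expo[OF that] trig_poly_def
    by (auto simp: sum.distrib sum_subtractf algebra_simps)
  show ?thesis
  proof (rule form_measure_concentrated[of "expo \<xi>" V])
    show "\<exists>v\<in>V. L2_norm \<Omega> (\<lambda>x. h x - v x) < \<epsilon>" if "h \<in> L2 \<Omega>" "\<epsilon> > 0" for h \<epsilon>
      using trig_poly_dense[OF that] by (auto simp: V_def)
    show "integrable (form_measure (expo \<xi>)) (\<lambda>x. x\<^sup>2)"
      using int[of "{\<xi>}" \<delta>] expo[of "{\<xi>}"] \<xi> by simp
    fix v assume "v \<in> V"
    then obtain F c where F: "finite F" "F \<subseteq> \<Lambda>" "\<xi> \<in> F" and v: "v = trig_poly F c"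
      using V by blast
    show "integrable (form_measure (\<lambda>x. expo \<xi> x + v x)) (\<lambda>x. x)"
      "integrable (form_measure (\<lambda>x. expo \<xi> x - v x)) (\<lambda>x. x)"
      unfolding v comb[OF F(1,3)]
      by (rule form_measure_id_integrable[OF trig_poly_L2[OF Omega_lmeasurable] int[OF F(1,2)]])+
    have "(\<integral>x. x \<partial>form_measure (\<lambda>x. expo \<xi> x + v x)) - (\<integral>x. x \<partial>form_measure (\<lambda>x. expo \<xi> x - v x))
       = ?L * (\<Sum>\<eta>\<in>F. \<eta> * ((cmod (\<delta> \<eta> + c \<eta>))\<^sup>2 - (cmod (\<delta> \<eta> - c \<eta>))\<^sup>2))"
      unfolding v comb[OF F(1,3)] form[OF F(1,2)]
      by (simp add: right_diff_distrib sum_subtractf)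
    \<comment> \<open>For \<open>\<eta> \<noteq> \<xi>\<close> the two squares agree because
      \<open>\<delta> \<eta> = 0\<close>; at \<open>\<xi>\<close> they differ by
      \<open>4 * Re (c \<xi>)\<close>.\<close>
    also have "(\<Sum>\<eta>\<in>F. \<eta> * ((cmod (\<delta> \<eta> + c \<eta>))\<^sup>2 - (cmod (\<delta> \<eta> - c \<eta>))\<^sup>2)) = (\<Sum>\<eta>\<in>F. if \<eta> = \<xi> then \<xi> * (4 * Re (c \<xi>)) else 0)"
      unfolding cmod_power2 by (intro sum.cong) (auto simp: \<delta>_def power2_eq_square algebra_simps)
    also have "\<dots> = \<xi> * (4 * Re (c \<xi>))" using F by (simp add: sum.delta')
    also have "L2_inner \<Omega> (expo \<xi>) v = of_real ?L * (\<Sum>\<eta>\<in>F. if \<eta> = \<xi> then cnj (c \<xi>) else 0)"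
      unfolding expo[OF F(1,3)] v trig_poly_inner[OF F(1,2)]
      by (intro arg_cong2[where f = "(*)"] sum.cong) (auto simp: \<delta>_def)
    then have "?L * Re (c \<xi>) = Re (L2_inner \<Omega> (expo \<xi>) v)"
      using F by (simp add: sum.delta')
    then have "?L * (\<xi> * (4 * Re (c \<xi>))) = 4 * \<xi> * Re (L2_inner \<Omega> (expo \<xi>) v)"
      by (metis mult.assoc mult.left_commute)
    finally show "(\<integral>x. x \<partial>form_measure (\<lambda>x. expo \<xi> x + v x)) - (\<integral>x. x \<partial>form_measure (\<lambda>x. expo \<xi> x - v x))
       = 4 * \<xi> * Re (L2_inner \<Omega> (expo \<xi>) v)" .
  qed (auto simp: V_def intro: expo_L2 trig_poly_L2 Omega_lmeasurable)
qed

end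

section \<open>The action of the group on exponentials\<close>

locale multiplicative_spectral_system = spectral_system +
  fixes U :: "real \<Rightarrow> (real \<Rightarrow> complex) \<Rightarrow> (real \<Rightarrow> complex)"
  assumes U: "unitary_group_of \<Omega> (D_op n \<alpha> \<beta> B) U"
    and mult: "multiplicative_group \<Omega> U"
begin

lemma U_L2: "f \<in> L2 \<Omega> \<Longrightarrow> U t f \<in> L2 \<Omega>"
  using U by (auto simp: unitary_group_of_def spectral_integral_def L2_linear_def)

lemma U_inner:
  assumes "\<xi> \<in> \<Lambda>" "h \<in> L2 \<Omega>"
  shows "L2_inner \<Omega> (U t (expo \<xi>)) h = expo t \<xi> * L2_inner \<Omega> (expo \<xi>) h"
    and "L2_inner \<Omega> (U t h) (expo \<xi>) = expo t \<xi> * L2_inner \<Omega> h (expo \<xi>)"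
proof -
  obtain E where E: "spectral_measure_of \<Omega> (D_op n \<alpha> \<beta> B) E"
    "spectral_integral \<Omega> E (\<lambda>x. exp (2 * of_real pi * \<i> * of_real t * of_real x)) (U t)"
    using U by (auto simp: unitary_group_of_def)
  interpret spectral_pvm \<Omega> E
    using E by unfold_locales (simp add: spectral_measure_of_def)
  have si: "spectral_integral \<Omega> E (expo t) (U t)"
    using E(2) by (simp add: expo_def[abs_def])
  note * = expo_L2[OF Omega_lmeasurable, of \<xi>] expo_form_measure_concentrated[OF E(1) assms(1)]
    borel_measurable_expo
  show "L2_inner \<Omega> (U t (expo \<xi>)) h = expo t \<xi> * L2_inner \<Omega> (expo \<xi>) h"
    by (rule spectral_integral_concentrated(1)[OF * _ si assms(2), where K = 1]) simp
  show "L2_inner \<Omega> (U t h) (expo \<xi>) = expo t \<xi> * L2_inner \<Omega> h (expo \<xi>)"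
    by (rule spectral_integral_concentrated(2)[OF * _ si assms(2), where K = 1]) simp
qed

lemma U_expo:
  assumes "\<xi> \<in> \<Lambda>"
  shows "L2_eq \<Omega> (U t (expo \<xi>)) (\<lambda>x. expo t \<xi> * expo \<xi> x)"
  by (rule L2_eqI)
     (use assms expo_L2[OF Omega_lmeasurable] in \<open>auto simp: U_inner L2_inner_scale intro: U_L2 L2_scale\<close>)

lemma spectrum_nonempty: "\<Lambda> \<noteq> {}"
proof
  assume "\<Lambda> = {}"
  then have "L2_norm \<Omega> (expo 0) = 0"
    by (intro orthogonal_imp_zero expo_L2 Omega_lmeasurable) auto
  then show False using L2_norm_expo[of 0] measure_Omega_pos by simp
qed

text \<open>An eigenfunction \<open>e\<^sub>\<xi>\<close> of the group is orthogonal to every other one, so maximality of the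
  orthogonal family forces \<open>\<xi>\<close> into the spectrum.\<close>

lemma eigen_in_spectrum:
  assumes "\<And>t. L2_eq \<Omega> (U t (expo \<xi>)) (\<lambda>x. expo t \<xi> * expo \<xi> x)"
  shows "\<xi> \<in> \<Lambda>"
proof (rule ccontr)
  assume "\<xi> \<notin> \<Lambda>"
  note eL = expo_L2[OF Omega_lmeasurable]
  have orth: "L2_inner \<Omega> (expo \<xi>) (expo \<eta>) = 0" if "\<eta> \<in> \<Lambda>" for \<eta>
  proof -
    \<comment> \<open>At this time the eigenvalues for \<open>\<xi>\<close> and
      \<open>\<eta>\<close> are opposite, so comparing them forces the inner product to
      vanish.\<close>
    define t where "t = 1 / (2 * (\<xi> - \<eta>))"
    have ne: "\<xi> \<noteq> \<eta>" using that \<open>\<xi> \<notin> \<Lambda>\<close> by auto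
    have "expo t \<eta> * L2_inner \<Omega> (expo \<xi>) (expo \<eta>) = L2_inner \<Omega> (U t (expo \<xi>)) (expo \<eta>)"
      by (rule U_inner(2)[OF that eL, symmetric])
    also have "\<dots> = L2_inner \<Omega> (\<lambda>x. expo t \<xi> * expo \<xi> x) (expo \<eta>)"
      by (rule L2_inner_cong[OF U_L2[OF eL] L2_scale[OF eL] eL assms])
    also have "\<dots> = expo t \<xi> * L2_inner \<Omega> (expo \<xi>) (expo \<eta>)" by (rule L2_inner_scale)
    finally have "expo t \<eta> * L2_inner \<Omega> (expo \<xi>) (expo \<eta>) = expo t \<xi> * L2_inner \<Omega> (expo \<xi>) (expo \<eta>)" .
    moreover have "expo t \<xi> = - expo t \<eta>"
    proof -
      have "2 * pi * t * \<xi> = pi + 2 * pi * t * \<eta>" using ne by (simp add: t_def field_simps)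
      then show ?thesis by (simp add: expo_cis cis_mult[symmetric])
    qed
    ultimately have "2 * (expo t \<eta> * L2_inner \<Omega> (expo \<xi>) (expo \<eta>)) = 0" by simp
    then show ?thesis by simp
  qed
  have "L2_norm \<Omega> (expo \<xi>) = 0"
    by (rule orthogonal_imp_zero[OF eL orth])
  then show False using L2_norm_expo[of \<xi>] measure_Omega_pos by simp
qed

text \<open>The functions \<open>U t (expo \<xi>)\<close> and \<open>U t (expo \<eta>)\<close> are
  known, and the latter has no zeros almost everywhere. Multiplicativity therefore determines
  \<open>U t (expo (\<xi> - \<eta>))\<close> by pointwise division.\<close>

lemma spectrum_diff:
  assumes "\<xi> \<in> \<Lambda>" "\<eta> \<in> \<Lambda>"
  shows "\<xi> - \<eta> \<in> \<Lambda>"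
proof (rule eigen_in_spectrum)
  fix t
  have *: "(\<lambda>x. expo (\<xi> - \<eta>) x * expo \<eta> x) = expo \<xi>" by (simp add: expo_mult fun_eq_iff)
  have "L2_eq \<Omega> (U t (\<lambda>x. expo (\<xi> - \<eta>) x * expo \<eta> x)) (\<lambda>x. U t (expo (\<xi> - \<eta>)) x * U t (expo \<eta>) x)"
    by (rule mult[unfolded multiplicative_group_def, rule_format])
       (simp_all add: * expo_L2 Omega_lmeasurable)
  then have "L2_eq \<Omega> (U t (expo \<xi>)) (\<lambda>x. U t (expo (\<xi> - \<eta>)) x * U t (expo \<eta>) x)" unfolding * .
  with U_expo[OF assms(1), of t] U_expo[OF assms(2), of t]
  show "L2_eq \<Omega> (U t (expo (\<xi> - \<eta>))) (\<lambda>x. expo t (\<xi> - \<eta>) * expo (\<xi> - \<eta>) x)"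
  proof eventually_elim
    fix x
    assume "U t (expo \<xi>) x = expo t \<xi> * expo \<xi> x" "U t (expo \<eta>) x = expo t \<eta> * expo \<eta> x"
      "U t (expo \<xi>) x = U t (expo (\<xi> - \<eta>)) x * U t (expo \<eta>) x"
    then have "U t (expo (\<xi> - \<eta>)) x * (expo t \<eta> * expo \<eta> x) = expo t \<xi> * expo \<xi> x" by simp
    also have "\<dots> = (expo t (\<xi> - \<eta>) * expo (\<xi> - \<eta>) x) * (expo t \<eta> * expo \<eta> x)"
      using expo_mult[of "\<xi> - \<eta>" t \<eta>] expo_mult[of "\<xi> - \<eta>" x \<eta>]
      by (simp add: expo_commute[of t] mult_ac)
    finally show "U t (expo (\<xi> - \<eta>)) x = expo t (\<xi> - \<eta>) * expo (\<xi> - \<eta>) x" by simp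
  qed
qed

end

section \<open>The spectrum is a lattice\<close>

text \<open>The gap at 0 makes the infimum of the positive elements positive and attained. Division
  with remainder by this least positive element leaves remainder 0.\<close>

lemma discrete_subgroup_cyclic:
  fixes A :: "real set"
  assumes diff: "\<And>x y. x \<in> A \<Longrightarrow> y \<in> A \<Longrightarrow> x - y \<in> A"
    and gap: "\<delta> > 0" "\<And>x. x \<in> A \<Longrightarrow> \<bar>x\<bar> < \<delta> \<Longrightarrow> x = 0"
    and ne: "x \<in> A" "x \<noteq> 0"
  obtains c where "c > 0" "A = {of_int k * c | k. True}"
proof -
  have zero: "0 \<in> A" using diff[OF ne(1) ne(1)] by simp
  have neg: "- y \<in> A" if "y \<in> A" for y using diff[OF zero that] by simp
  have add: "y + z \<in> A" if "y \<in> A" "z \<in> A" for y z using diff[OF that(1) neg[OF that(2)]] by simp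
  define P where "P = {y\<in>A. y > 0}"
  have "P \<noteq> {}" using ne neg[OF ne(1)] by (cases "x > 0") (auto simp: P_def)
  have bdd: "bdd_below P" by (rule bdd_belowI[of _ 0]) (auto simp: P_def)
  define c where "c = Inf P"
  have lower: "c \<le> y" if "y \<in> P" for y using that bdd by (auto simp: c_def intro: cInf_lower)
  have "\<delta> \<le> y" if "y \<in> P" for y using gap(2)[of y] that by (auto simp: P_def not_less[symmetric])
  then have "\<delta> \<le> c" unfolding c_def by (intro cInf_greatest \<open>P \<noteq> {}\<close>)
  then have "c > 0" using gap(1) by simp
  obtain y where y: "y \<in> P" "y < c + \<delta>"
    using cInf_lessD[OF \<open>P \<noteq> {}\<close>, of "c + \<delta>"] gap(1) by (auto simp: c_def)
  have "c \<in> P"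
  proof (rule ccontr)
    assume "c \<notin> P"
    \<comment> \<open>An infimum that is not attained yields two distinct positive elements in the
      interval from \<open>c\<close> to \<open>c + \<delta>\<close>, at distance below
      \<open>\<delta>\<close>.\<close>
    then have "c < y" using lower[OF y(1)] y(1) by (cases "c = y") auto
    then obtain z where z: "z \<in> P" "z < y"
      using cInf_lessD[OF \<open>P \<noteq> {}\<close>, of y] by (auto simp: c_def)
    have "y - z \<in> A" using diff z y by (auto simp: P_def)
    then show False using gap(2)[of "y - z"] z y lower[OF z(1)] by auto
  qed
  then have cA: "c \<in> A" by (simp add: P_def)
  have nat: "of_nat m * c \<in> A" for m :: nat
    by (induction m) (use zero add cA in \<open>auto simp: distrib_right\<close>)
  have int: "of_int k * c \<in> A" for k :: int
    by (cases k rule: int_cases2) (use nat neg in auto)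
  have "\<exists>k. y = of_int k * c" if "y \<in> A" for y
  proof -
    define r where "r = y - of_int \<lfloor>y / c\<rfloor> * c"
    have "r \<in> A" unfolding r_def by (intro diff that int)
    have "r \<ge> 0" "r < c"
      using floor_divide_lower[OF \<open>c > 0\<close>, of y] floor_divide_upper[OF \<open>c > 0\<close>, of y]
      by (auto simp: r_def algebra_simps)
    then have "r = 0" using lower[of r] \<open>r \<in> A\<close> by (cases "r = 0") (auto simp: P_def)
    then show ?thesis by (auto simp: r_def)
  qed
  then have "A = {of_int k * c | k. True}" using int by auto
  with \<open>c > 0\<close> show ?thesis using that by blast
qed

text \<open>Passing to \<open>lborel\<close> makes the translation invariance of the integral
  available.\<close>

lemma lebesgue_on_integral_indicator:
  fixes g :: "real \<Rightarrow> complex"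
  assumes "S \<in> sets borel" "J \<in> sets borel" "J \<subseteq> S" and [measurable]: "g \<in> borel_measurable borel"
  shows "(\<integral>x. indicator J x * g x \<partial>lebesgue_on S) = (\<integral>x. indicator J x * g x \<partial>lborel)"
proof -
  have [measurable]: "J \<in> sets borel" by fact
  have "(\<integral>x. indicator J x * g x \<partial>lebesgue_on S) = (\<integral>x. indicator S x *\<^sub>R (indicator J x * g x) \<partial>lebesgue)"
    using assms(1) by (subst integral_restrict_space) auto
  also have "(\<lambda>x. indicator S x *\<^sub>R (indicator J x * g x)) = (\<lambda>x. indicator J x * g x)"
    using assms(3) by (auto simp: indicator_def fun_eq_iff)
  also have "(\<integral>x. indicator J x * g x \<partial>lebesgue) = (\<integral>x. indicator J x * g x \<partial>lborel)"
    by (rule integral_completion) measurable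
  finally show ?thesis .
qed

context spectral_system
begin

text \<open>If \<open>x\<close> and \<open>x + t\<close> both lie in \<open>\<Omega>\<close>, the difference of the indicators of a small interval
  around \<open>x\<close> and of its translate is orthogonal to all \<open>t\<close>-periodic exponentials.\<close>

lemma no_period_in_Omega:
  assumes per: "\<And>\<xi>. \<xi> \<in> \<Lambda> \<Longrightarrow> expo \<xi> t = 1" and x: "x \<in> \<Omega>" "x + t \<in> \<Omega>"
  shows "t = 0"
proof (rule ccontr)
  assume "t \<noteq> 0"
  obtain r1 where r1: "r1 > 0" "ball x r1 \<subseteq> \<Omega>"
    using Omega_open x(1) by (meson open_contains_ball)
  obtain r2 where r2: "r2 > 0" "ball (x + t) r2 \<subseteq> \<Omega>"
    using Omega_open x(2) by (meson open_contains_ball)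
  \<comment> \<open>The bounds \<open>r1\<close> and \<open>r2\<close> keep both intervals inside
    \<open>\<Omega>\<close>; the bound \<open>\<bar>t\<bar> / 2\<close> keeps them disjoint.\<close>
  define r where "r = min (min r1 r2) (\<bar>t\<bar> / 2)"
  have r: "r > 0" "r \<le> r1" "r \<le> r2" "r \<le> \<bar>t\<bar> / 2" using r1 r2 \<open>t \<noteq> 0\<close> by (auto simp: r_def)
  define J where "J = {x - r<..<x + r}"
  define J' where "J' = {x + t - r<..<x + t + r}"
  have J: "J \<subseteq> \<Omega>" "J' \<subseteq> \<Omega>"
    using r1(2) r2(2) r by (auto simp: J_def J'_def subset_iff dist_real_def)
  have [measurable]: "J \<in> sets borel" "J' \<in> sets borel" by (auto simp: J_def J'_def)
  define w :: "real \<Rightarrow> complex" where "w = (\<lambda>y. indicator J y - indicator J' y)"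
  have ind: "(\<lambda>y. indicator K y :: complex) \<in> L2 \<Omega>" if "K \<in> sets borel" for K
  proof (rule L2_bounded[OF Omega_lmeasurable, where K = 1])
    show "(\<lambda>y. indicator K y :: complex) \<in> borel_measurable (lebesgue_on \<Omega>)"
      using that by (intro measurable_restrict_space1 measurable_completion) auto
  qed (auto simp: indicator_def)
  have w: "w \<in> L2 \<Omega>" unfolding w_def by (intro L2_diff ind) auto
  have "L2_inner \<Omega> w (expo \<eta>) = 0" if "\<eta> \<in> \<Lambda>" for \<eta>
  proof -
    have 1: "L2_inner \<Omega> (indicator K) (expo \<eta>) = (\<integral>y. indicator K y * cnj (expo \<eta> y) \<partial>lborel)"
      if "K \<in> sets borel" "K \<subseteq> \<Omega>" for K
      unfolding L2_inner_def
      by (rule lebesgue_on_integral_indicator) (use that Omega_open in auto)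
    have per': "expo \<eta> (t + y) = expo \<eta> y" for y
      using per[OF that] expo_mult[of t \<eta> y] by (simp add: expo_commute[of \<eta>])
    have J'J: "indicator J' (t + y) = (indicator J y :: complex)" for y
      by (auto simp: indicator_def J_def J'_def)
    have "(\<integral>y. indicator J' y * cnj (expo \<eta> y) \<partial>lborel) = (\<integral>y. indicator J' (t + y) * cnj (expo \<eta> (t + y)) \<partial>lborel)"
      using lborel_integral_real_affine[of 1 "\<lambda>y. indicator J' y * cnj (expo \<eta> y)" t] by simp
    also have "\<dots> = (\<integral>y. indicator J y * cnj (expo \<eta> y) \<partial>lborel)"
      by (simp only: per' J'J)
    finally have "L2_inner \<Omega> (indicator J') (expo \<eta>) = L2_inner \<Omega> (indicator J) (expo \<eta>)"
      using J by (simp add: 1)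
    then show ?thesis
      unfolding w_def using ind expo_L2[OF Omega_lmeasurable] by (subst L2_inner_diff) auto
  qed
  then have "L2_norm \<Omega> w = 0" by (rule orthogonal_imp_zero[OF w])
  then have "L2_eq \<Omega> w (\<lambda>x. 0)" by (intro L2_inner_self_zero w) (simp add: L2_inner_self)
  then have "AE y in lebesgue. y \<in> \<Omega> \<longrightarrow> w y = 0"
    using Omega_lmeasurable by (subst (asm) AE_restrict_space_iff) auto
  moreover have "J \<inter> J' = {}"
    using r by (auto simp: J_def J'_def abs_if split: if_splits)
  ultimately have "AE y in lebesgue. y \<notin> J"
    using J by (elim eventually_mono) (auto simp: w_def indicator_def split: if_splits)
  then have "emeasure lebesgue J = 0"
    by (subst (asm) AE_iff_measurable[of J]) auto
  then show False using r(1) by (simp add: J_def)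
qed

end

context multiplicative_spectral_system
begin

lemma spectrum_zero: "0 \<in> \<Lambda>"
  using spectrum_nonempty spectrum_diff by (metis all_not_in_conv diff_self)

text \<open>If \<open>\<Omega>\<close> lies within distance \<open>R\<close> of 0 and
  \<open>\<bar>\<xi>\<bar> < 1 / (4 * R)\<close>, then \<open>expo \<xi>\<close> has positive real
  part on \<open>\<Omega>\<close>, so it cannot be orthogonal to the constant
  \<open>expo 0\<close>.\<close>

lemma spectrum_gap: "\<exists>\<delta>>0. \<forall>\<xi>\<in>\<Lambda>. \<bar>\<xi>\<bar> < \<delta> \<longrightarrow> \<xi> = 0"
proof -
  have "bounded \<Omega>" by (rule Omega_bounded)
  then obtain R where R: "R > 0" "\<And>x. x \<in> \<Omega> \<Longrightarrow> \<bar>x\<bar> \<le> R"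
    by (auto simp: bounded_pos)
  show ?thesis
  proof (intro exI[of _ "1 / (4 * R)"] conjI ballI impI)
    show "1 / (4 * R) > 0" using R by simp
    fix \<xi> assume \<xi>: "\<xi> \<in> \<Lambda>" "\<bar>\<xi>\<bar> < 1 / (4 * R)"
    have pos: "Re (expo \<xi> x) > 0" if "x \<in> \<Omega>" for x
    proof -
      have "\<bar>\<xi>\<bar> * \<bar>x\<bar> \<le> \<bar>\<xi>\<bar> * R" using R(2)[OF that] by (intro mult_left_mono) auto
      also have "\<dots> < 1 / 4" using \<xi>(2) R(1) by (simp add: field_simps)
      finally have "\<bar>\<xi> * x\<bar> < 1 / 4" by (simp add: abs_mult)
      then have "\<bar>2 * pi * (\<xi> * x)\<bar> < pi / 2" by (simp add: abs_mult)
      then have "- (pi / 2) < 2 * pi * (\<xi> * x)" "2 * pi * (\<xi> * x) < pi / 2"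
        by linarith+
      then have "cos (2 * pi * (\<xi> * x)) > 0" by (rule cos_gt_zero_pi)
      then show ?thesis by (simp add: expo_cis mult.assoc)
    qed
    show "\<xi> = 0"
    proof (rule ccontr)
      assume "\<xi> \<noteq> 0"
      then have "L2_inner \<Omega> (expo \<xi>) (expo 0) = 0" using expo_orth[OF \<xi>(1) spectrum_zero] by simp
      then have i0: "integral\<^sup>L (lebesgue_on \<Omega>) (expo \<xi>) = 0" by (simp add: expo_inner)
      have "integrable (lebesgue_on \<Omega>) (\<lambda>x. expo \<xi> x * cnj (expo 0 x))"
        by (intro L2_inner_integrable expo_L2 Omega_lmeasurable)
      then have i: "integrable (lebesgue_on \<Omega>) (expo \<xi>)" by (simp add: expo_cis[of 0])
      then have "(\<integral>x. Re (expo \<xi> x) \<partial>lebesgue_on \<Omega>) = 0" using i0 by simp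
      then have "AE x in lebesgue_on \<Omega>. Re (expo \<xi> x) = 0"
        using i pos by (subst (asm) integral_nonneg_eq_0_iff_AE) (auto intro!: AE_I2 less_imp_le)
      moreover have "AE x in lebesgue_on \<Omega>. Re (expo \<xi> x) > 0"
        using pos by (intro AE_I2) simp
      ultimately have "AE x in lebesgue_on \<Omega>. False" by eventually_elim simp
      then have "emeasure (lebesgue_on \<Omega>) (space (lebesgue_on \<Omega>)) = 0"
        by (simp add: AE_iff_null null_sets_def)
      then have "measure lebesgue \<Omega> = 0"
        using Omega_lmeasurable by (simp add: emeasure_restrict_space measure_def fmeasurableD)
      then show False using measure_Omega_pos by simp
    qed
  qed
qed

lemma spectrum_lattice:
  obtains c where "c > 0" "\<Lambda> = {of_int k * c | k. True}"
proof -
  obtain \<delta> where \<delta>: "\<delta> > 0" "\<And>\<xi>. \<xi> \<in> \<Lambda> \<Longrightarrow> \<bar>\<xi>\<bar> < \<delta> \<Longrightarrow> \<xi> = 0"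
    using spectrum_gap by blast
  have "\<exists>\<xi>\<in>\<Lambda>. \<xi> \<noteq> 0"
  proof (rule ccontr)
    assume "\<not> ?thesis"
    then have per: "\<And>\<xi> t. \<xi> \<in> \<Lambda> \<Longrightarrow> expo \<xi> t = 1" by (auto simp: expo_cis)
    \<comment> \<open>If 0 were the only frequency, every number would be a common period. A third
      of the first interval is one that joins two points of \<open>\<Omega>\<close>.\<close>
    define l where "l = (\<beta> 0 - \<alpha> 0) / 3"
    have l: "l > 0" using lt[of 0] n_pos by (simp add: l_def)
    have om: "\<alpha> 0 + l \<in> \<Omega>" "\<alpha> 0 + l + l \<in> \<Omega>"
      using n_pos l by (auto intro!: in_Omega[of 0] simp: l_def field_simps)
    show False using no_period_in_Omega[OF per om] l by simp
  qed
  then obtain \<xi> where \<xi>: "\<xi> \<in> \<Lambda>" "\<xi> \<noteq> 0" by blast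
  show ?thesis
    by (rule discrete_subgroup_cyclic[OF spectrum_diff \<delta> \<xi>]) (assumption | rule that)+
qed

end

lemma expo_eq_imp:
  assumes "c > 0" "expo c x = expo c y"
  shows "\<exists>k::int. x = y + of_int k * (1 / c)"
proof -
  have "cos (2 * pi * c * x) = cos (2 * pi * c * y)" "sin (2 * pi * c * x) = sin (2 * pi * c * y)"
    using assms(2) by (simp_all add: expo_cis complex_eq_iff)
  then obtain k :: int where "2 * pi * c * x = 2 * pi * c * y + 2 * pi * of_int k"
    using sin_cos_eq_iff[of "2 * pi * c * x" "2 * pi * c * y"] by auto
  then have "2 * pi * (c * x) = 2 * pi * (c * y + of_int k)" by (simp add: algebra_simps)
  then have "c * x = c * y + of_int k" by simp
  then show ?thesis using assms(1) by (intro exI[of _ k]) (simp add: field_simps)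
qed

section \<open>Interval systems whose endpoints are matched by a permutation\<close>

text \<open>This isolates the geometry from the analysis. The period \<open>T\<close> will be
  \<open>1 / c\<close> for a spectrum generated by \<open>c\<close>; that it is the total length is
  a result, \<open>T_eq\<close>.\<close>

locale interval_exchange = interval_system +
  fixes T :: real and \<sigma> :: "nat \<Rightarrow> nat"
  assumes T_pos: "T > 0"
    and disj: "x \<in> \<Omega> \<Longrightarrow> x + of_int k * T \<in> \<Omega> \<Longrightarrow> k = 0"
    and perm: "\<sigma> permutes {..<n}"
    and link: "i < n \<Longrightarrow> \<exists>k::int. \<beta> i = \<alpha> (\<sigma> i) + of_int k * T"
begin

section \<open>The orbit of the first index and the moved intervals\<close>

definition orb :: "nat \<Rightarrow> nat" where "orb k = (\<sigma> ^^ k) 0"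

definition a :: "nat \<Rightarrow> real" where "a k = \<alpha> 0 + (\<Sum>j<k. \<beta> (orb j) - \<alpha> (orb j))"

abbreviation "\<tau> \<equiv> shift \<alpha> \<beta> \<sigma>"

lemma orb_less: "orb k < n"
proof (induction k)
  case (Suc k)
  then show ?case using permutes_in_image[OF perm, of "orb k"] by (simp add: orb_def)
qed (use n_pos in \<open>simp add: orb_def\<close>)

lemma a_0 [simp]: "a 0 = \<alpha> 0" by (simp add: a_def)

lemma a_Suc: "a (Suc k) = a k + (\<beta> (orb k) - \<alpha> (orb k))" by (simp add: a_def)

lemma a_strict_mono: "strict_mono a"
  unfolding strict_mono_Suc_iff a_Suc using lt[OF orb_less] by simp

lemma a_less_iff: "a j < a k \<longleftrightarrow> j < k"
  by (rule strict_mono_less[OF a_strict_mono])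

lemma a_le_iff: "a j \<le> a k \<longleftrightarrow> j \<le> k"
  by (rule strict_mono_less_eq[OF a_strict_mono])

text \<open>The increment of \<open>\<tau>\<close> from \<open>k\<close> to \<open>Suc k\<close> is
  the offset that puts the next interval of the orbit at the right end of the interval moved
  before.\<close>

lemma shift_left: "\<alpha> (orb k) + \<tau> k = a k"
proof (induction k)
  case (Suc k)
  have "\<tau> (Suc k) = \<tau> k + (\<beta> (orb k) - \<alpha> (orb (Suc k)))"
    by (simp add: shift_def orb_def)
  then show ?case using Suc by (simp add: a_Suc)
qed (simp add: shift_def orb_def)

lemma shift_right: "\<beta> (orb k) + \<tau> k = a (Suc k)"
  using shift_left[of k] by (simp add: a_Suc)

lemma shift_lattice: "\<exists>m::int. \<tau> k = of_int m * T"
proof (induction k)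
  case (Suc k)
  then obtain m where m: "\<tau> k = of_int m * T" by blast
  obtain q :: int where "\<beta> (orb k) = \<alpha> (orb (Suc k)) + of_int q * T"
    using link[OF orb_less, of k] by (auto simp: orb_def)
  then have "\<tau> (Suc k) = of_int (m + q) * T"
    using m by (simp add: shift_def orb_def algebra_simps)
  then show ?case by blast
qed (simp add: shift_def)

lemma shift_image:
  "(\<lambda>x. x + \<tau> k) ` {\<alpha> (orb k)<..<\<beta> (orb k)} = {a k<..<a (Suc k)}"
proof -
  have "y \<in> (\<lambda>x. x + \<tau> k) ` {\<alpha> (orb k)<..<\<beta> (orb k)}" if "a k < y" "y < a (Suc k)" for y
    using that shift_left[of k] shift_right[of k] by (intro image_eqI[of _ _ "y - \<tau> k"]) auto
  then show ?thesis using shift_left[of k] shift_right[of k] by auto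
qed

lemma a_locate: "a 0 \<le> y \<Longrightarrow> y < a m \<Longrightarrow> \<exists>k<m. a k \<le> y \<and> y < a (Suc k)"
  by (induction m) (auto simp: less_Suc_eq, force)

text \<open>The moved intervals of the orbit of \<open>0\<close> fill up \<open>[a 0, a m)\<close>, and translates of \<open>\<Omega>\<close> by
  different multiples of \<open>T\<close> do not overlap.\<close>

lemma orbit_catches:
  assumes i: "i < n" "\<alpha> i < x" "x < \<beta> i" and y: "a 0 \<le> x + of_int q * T" "x + of_int q * T < a m"
  shows "\<exists>k<m. i = orb k \<and> \<tau> k = of_int q * T"
proof -
  obtain k where k: "k < m" "a k \<le> x + of_int q * T" "x + of_int q * T < a (Suc k)"
    using a_locate[OF y] by blast
  \<comment> \<open>The translated point may be a junction \<open>a k\<close>, outside all open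
    moved intervals. A small push to the right brings it inside without leaving interval
    \<open>i\<close>.\<close>
  obtain \<epsilon> where \<epsilon>: "\<epsilon> > 0" "\<epsilon> < \<beta> i - x" "\<epsilon> < a (Suc k) - (x + of_int q * T)"
    using field_lbound_gt_zero[of "\<beta> i - x" "a (Suc k) - (x + of_int q * T)"] i k by auto
  obtain p :: int where p: "\<tau> k = of_int p * T" using shift_lattice by blast
  have x1: "x + \<epsilon> \<in> \<Omega>" using i \<epsilon> by (intro in_Omega) auto
  \<comment> \<open>Undoing the shift \<open>\<tau> k\<close> sends the pushed point to the original
    interval \<open>orb k\<close>; so \<open>z\<close> and \<open>x + \<epsilon>\<close> both lie in
    \<open>\<Omega>\<close> and differ by a multiple of \<open>T\<close>.\<close>
  define z where "z = x + \<epsilon> + of_int (q - p) * T"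
  have z: "\<alpha> (orb k) < z" "z < \<beta> (orb k)"
    using k \<epsilon> shift_left[of k] shift_right[of k] p by (auto simp: z_def algebra_simps)
  have "q - p = 0"
    by (rule disj[OF x1]) (use in_Omega[OF orb_less z] in \<open>simp add: z_def\<close>)
  then have "z = x + \<epsilon>" "\<tau> k = of_int q * T" using p by (auto simp: z_def)
  moreover have "i = orb k"
    using interval_unique[OF i(1) orb_less[of k], of z] z i \<epsilon> \<open>z = x + \<epsilon>\<close> by auto
  ultimately show ?thesis using k(1) by blast
qed

definition period :: nat where "period = least_power \<sigma> 0"

lemma permutation: "permutation \<sigma>"
  using perm permutation_permutes by blast

lemma orb_period: "orb period = 0" "period > 0"
  unfolding period_def orb_def using least_power_of_permutation[OF permutation] by auto

lemma support_eq: "support \<sigma> 0 = map orb [0..<period]"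
  by (simp add: period_def orb_def)

lemma orb_inj: "inj_on orb {..<period}"
  using cycle_of_permutation[OF permutation, of 0] unfolding support_eq
  by (simp add: distinct_map atLeast_upt)

lemma a_period: "a period = \<alpha> 0 + \<tau> period"
  using shift_left[of period] by (simp add: orb_period)

text \<open>After one period the orbit is back at 0, so the filled length is itself a shift, hence a
  multiple of \<open>T\<close>; it is positive since \<open>a\<close> increases.\<close>

lemma a_period_ge: "\<exists>p::int. p \<ge> 1 \<and> a period = \<alpha> 0 + of_int p * T"
proof -
  obtain p :: int where p: "\<tau> period = of_int p * T" using shift_lattice by blast
  have "a 0 < a period" using a_less_iff[of 0 period] orb_period(2) by simp
  then have "of_int p * T > 0" using a_period p by simp
  then have "p > 0" using T_pos by (simp add: zero_less_mult_iff)
  then show ?thesis using a_period p by (intro exI[of _ p]) auto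
qed

lemma mod_T: "\<exists>q::int. y \<le> x + of_int q * T \<and> x + of_int q * T < y + T"
proof -
  define q where "q = - \<lfloor>(x - y) / T\<rfloor>"
  have "of_int \<lfloor>(x - y) / T\<rfloor> * T \<le> x - y" "x - y < (of_int \<lfloor>(x - y) / T\<rfloor> + 1) * T"
    using floor_divide_lower[OF T_pos] floor_divide_upper[OF T_pos] by blast+
  then show ?thesis by (intro exI[of _ q]) (auto simp: q_def algebra_simps)
qed

lemma a_period_ge': "\<alpha> 0 + T \<le> a period"
proof -
  obtain p :: int where p: "p \<ge> 1" "a period = \<alpha> 0 + of_int p * T" using a_period_ge by blast
  have "1 * T \<le> of_int p * T" using p(1) T_pos by (intro mult_right_mono) auto
  then show ?thesis using p(2) by simp
qed

text \<open>The orbit fills at least one period. The midpoint of any interval can be translated into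
  that period, where \<open>orbit_catches\<close> places its index in the orbit.\<close>

lemma orb_surj: "orb ` {..<period} = {..<n}"
proof (intro subset_antisym subsetI)
  fix i assume "i \<in> {..<n}"
  then have i: "i < n" by simp
  define x where "x = (\<alpha> i + \<beta> i) / 2"
  have x: "\<alpha> i < x" "x < \<beta> i" using lt[OF i] by (auto simp: x_def)
  obtain q :: int where q: "\<alpha> 0 \<le> x + of_int q * T" "x + of_int q * T < \<alpha> 0 + T"
    using mod_T by blast
  show "i \<in> orb ` {..<period}"
    using orbit_catches[OF i x, of q period] q a_period_ge' by auto
qed (use orb_less in auto)

lemma period_eq: "period = n"
  using card_image[OF orb_inj] by (simp add: orb_surj)

lemma orb_bij: "bij_betw orb {..<n} {..<n}"
  using orb_inj orb_surj by (simp add: bij_betw_def period_eq)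

text \<open>If two periods were filled, a point just right of \<open>\<alpha> 0\<close> translated
  by \<open>T\<close> would be caught by some \<open>k\<close> with \<open>orb k = 0\<close> and
  \<open>\<tau> k = T\<close>. Injectivity of the orbit gives \<open>k = 0\<close>, whereas
  \<open>\<tau> 0 = 0\<close>.\<close>

lemma a_n: "a n = \<alpha> 0 + T"
proof -
  obtain p :: int where p: "p \<ge> 1" "a n = \<alpha> 0 + of_int p * T"
    using a_period_ge period_eq by auto
  have "p = 1"
  proof (rule ccontr)
    assume "p \<noteq> 1"
    then have "2 * T \<le> of_int p * T" using p(1) T_pos by (intro mult_right_mono) auto
    then have big: "\<alpha> 0 + 2 * T \<le> a n" using p(2) by simp
    obtain \<epsilon> where \<epsilon>: "\<epsilon> > 0" "\<epsilon> < \<beta> 0 - \<alpha> 0" "\<epsilon> < T"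
      using field_lbound_gt_zero[of "\<beta> 0 - \<alpha> 0" T] lt[of 0] n_pos T_pos by auto
    define x where "x = \<alpha> 0 + \<epsilon>"
    have x: "\<alpha> 0 < x" "x < \<beta> 0" "x < \<alpha> 0 + T"
      using \<epsilon> by (auto simp: x_def)
    obtain k where k: "k < n" "0 = orb k" "\<tau> k = T"
      using orbit_catches[of 0 x 1 n] x n_pos big T_pos by auto
    have "k = 0"
      using inj_onD[OF orb_inj, of k 0] k n_pos by (auto simp: period_eq orb_def)
    then show False using k(3) T_pos by (simp add: shift_def)
  qed
  then show ?thesis using p by simp
qed

lemma T_eq: "T = (\<Sum>i<n. \<beta> i - \<alpha> i)"
proof -
  have "T = (\<Sum>j<n. \<beta> (orb j) - \<alpha> (orb j))" using a_n by (simp add: a_def)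
  also have "\<dots> = (\<Sum>i<n. \<beta> i - \<alpha> i)" by (rule sum.reindex_bij_betw[OF orb_bij])
  finally show ?thesis .
qed

lemma full_cycle: "full_cycle n \<sigma>"
proof -
  let ?cs = "map orb [0..<n]"
  have cs: "?cs = support \<sigma> 0" using support_eq period_eq by simp
  have set: "set ?cs = {..<n}" using orb_surj by (simp add: period_eq atLeast_upt)
  have "\<sigma> = cycle_of_list ?cs"
  proof
    fix b
    show "\<sigma> b = cycle_of_list ?cs b"
    proof (cases "b < n")
      case True
      then show ?thesis using cycle_restrict[OF permutation, of b 0] set unfolding cs by simp
    next
      case False
      then show ?thesis
        using id_outside_supp[of b ?cs] permutes_not_in[OF perm, of b] set by simp
    qed
  qed
  moreover have "cycle ?cs" using cycle_of_permutation[OF permutation, of 0] unfolding cs .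
  ultimately show ?thesis
    unfolding full_cycle_def using perm set by (intro conjI exI[of _ ?cs]) auto
qed

section \<open>Tiling, filled interval and translation congruence\<close>

lemma tiles: "tiles_reals \<Omega> {of_int k * T | k :: int. True}"
  unfolding tiles_reals_def
proof (intro conjI ballI impI)
  fix s t assume "s \<in> {of_int k * T | k :: int. True}" "t \<in> {of_int k * T | k :: int. True}" "s \<noteq> t"
  then obtain k k' :: int where k: "s = of_int k * T" "t = of_int k' * T" "k \<noteq> k'" by auto
  have "(+) s ` \<Omega> \<inter> (+) t ` \<Omega> = {}"
  proof (intro equals0I)
    fix y assume "y \<in> (+) s ` \<Omega> \<inter> (+) t ` \<Omega>"
    then obtain x x' where "x \<in> \<Omega>" "x' \<in> \<Omega>" "s + x = t + x'" by auto
    then have "x + of_int (k - k') * T = x'" using k by (simp add: algebra_simps)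
    then show False using disj[OF \<open>x \<in> \<Omega>\<close>, of "k - k'"] \<open>x' \<in> \<Omega>\<close> k(3) by auto
  qed
  then show "(+) s ` \<Omega> \<inter> (+) t ` \<Omega> \<in> null_sets lebesgue" by simp
next
  \<comment> \<open>Points outside all translates can only be translates of the junctions, a
    countable set.\<close>
  let ?C = "(\<lambda>(k, q :: int). a k + of_int q * T) ` UNIV"
  have "UNIV - (\<Union>t\<in>{of_int k * T | k :: int. True}. (+) t ` \<Omega>) \<subseteq> ?C"
  proof
    fix y assume y: "y \<in> UNIV - (\<Union>t\<in>{of_int k * T | k :: int. True}. (+) t ` \<Omega>)"
    obtain q :: int where q: "a 0 \<le> y + of_int q * T" "y + of_int q * T < a n"
      using mod_T[of "\<alpha> 0" y] a_n by auto
    obtain k where k: "a k \<le> y + of_int q * T" "y + of_int q * T < a (Suc k)"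
      using a_locate[OF q] by blast
    obtain p :: int where p: "\<tau> k = of_int p * T" using shift_lattice by blast
    have "\<not> a k < y + of_int q * T"
    proof
      assume "a k < y + of_int q * T"
      then have "y + of_int q * T \<in> (\<lambda>x. x + \<tau> k) ` {\<alpha> (orb k)<..<\<beta> (orb k)}"
        using k unfolding shift_image by simp
      then obtain x where x: "\<alpha> (orb k) < x" "x < \<beta> (orb k)" "y + of_int q * T = x + of_int p * T"
        using p by auto
      then have "y = of_int (p - q) * T + x" by (simp add: algebra_simps)
      then have "y \<in> (\<Union>t\<in>{of_int k * T | k :: int. True}. (+) t ` \<Omega>)"
        using in_Omega[OF orb_less x(1,2)] by blast
      then show False using y by blast
    qed
    then have "y = a k + of_int (- q) * T" using k by simp
    then show "y \<in> ?C" by (intro image_eqI[of _ _ "(k, - q)"]) auto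
  qed
  moreover have "countable ?C" by (intro countable_image) auto
  ultimately show "UNIV - (\<Union>t\<in>{of_int k * T | k :: int. True}. (+) t ` \<Omega>) \<in> null_sets lebesgue"
    by (intro null_sets_completionI countable_imp_null_set_lborel) (rule countable_subset)
qed

lemma union_moved:
  "\<exists>F. finite F \<and> {\<alpha> 0<..<\<beta> 0} \<union> (\<Union>k\<in>{1..n - 1}. {a k<..<a (Suc k)}) = {\<alpha> 0<..<\<alpha> 0 + T} - F"
\<comment> \<open>Only the inner junctions are really removed; \<open>a 0\<close> is the left end of
  the open interval and does not belong to it.\<close>
proof (intro exI[of _ "a ` {..<n}"] conjI equalityI subsetI)
  have first: "{\<alpha> 0<..<\<beta> 0} = {a 0<..<a (Suc 0)}" by (simp add: a_Suc orb_def)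
  fix y
  {
    assume "y \<in> {\<alpha> 0<..<\<beta> 0} \<union> (\<Union>k\<in>{1..n - 1}. {a k<..<a (Suc k)})"
    then have "y \<in> {a 0<..<a (Suc 0)} \<or> (\<exists>k\<in>{1..n - 1}. y \<in> {a k<..<a (Suc k)})"
      using first by auto
    moreover have "0 < n" "\<And>k. k \<in> {1..n - 1} \<Longrightarrow> k < n" using n_pos by auto
    ultimately have "\<exists>k<n. a k < y \<and> y < a (Suc k)"
      by (metis greaterThanLessThan_iff)
    then obtain k where k: "k < n" "a k < y" "y < a (Suc k)" by blast
    have "a 0 \<le> a k" "a (Suc k) \<le> a n" using k(1) by (auto simp only: a_le_iff)
    moreover have "y \<noteq> a j" for j
      using k a_le_iff[of j k] a_le_iff[of "Suc k" j] by (cases "j \<le> k") auto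
    ultimately show "y \<in> {\<alpha> 0<..<\<alpha> 0 + T} - a ` {..<n}" using k a_n by auto
  next
    assume y: "y \<in> {\<alpha> 0<..<\<alpha> 0 + T} - a ` {..<n}"
    then obtain k where k: "k < n" "a k \<le> y" "y < a (Suc k)"
      using a_locate[of y n] a_n by auto
    with y have "a k < y" by (auto simp: less_le)
    then show "y \<in> {\<alpha> 0<..<\<beta> 0} \<union> (\<Union>k\<in>{1..n - 1}. {a k<..<a (Suc k)})"
      using k unfolding first by (cases "k = 0") (auto intro!: bexI[of _ k])
  }
qed auto

lemma congruence:
  assumes m: "\<And>k. k < n \<Longrightarrow> \<tau> k = of_int (m k) * T"
  shows "\<exists>P'. translation_congruence_via T \<Omega> {\<alpha> 0<..<\<alpha> 0 + T} {..<n}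
           (\<lambda>k. {\<alpha> (orb k)<..<\<beta> (orb k)}) P' m"
proof
  \<comment> \<open>The target must be partitioned exactly, but the open moved intervals omit the
    inner junctions. Every piece except the first therefore includes its left end, which changes it
    by a null set.\<close>
  define P' where "P' k = (if k = 0 then {a 0<..<a (Suc 0)} else {a k..<a (Suc k)})" for k
  have sub: "{a k<..<a (Suc k)} \<subseteq> P' k" "P' k \<subseteq> insert (a k) {a k<..<a (Suc k)}" for k
    by (auto simp: P'_def)
  show "translation_congruence_via T \<Omega> {\<alpha> 0<..<\<alpha> 0 + T} {..<n}
           (\<lambda>k. {\<alpha> (orb k)<..<\<beta> (orb k)}) P' m"
    unfolding translation_congruence_via_def
  proof (intro conjI ballI)
    show "disjoint_family_on (\<lambda>k. {\<alpha> (orb k)<..<\<beta> (orb k)}) {..<n}"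
      unfolding disjoint_family_on_def
    proof (intro ballI impI)
      fix j k assume "j \<in> {..<n}" "k \<in> {..<n}" "j \<noteq> k"
      then have "orb j \<noteq> orb k" using orb_inj by (auto simp: period_eq inj_on_def)
      then show "{\<alpha> (orb j)<..<\<beta> (orb j)} \<inter> {\<alpha> (orb k)<..<\<beta> (orb k)} = {}"
        using interval_unique[OF orb_less[of j] orb_less[of k]] by fastforce
    qed
    have "\<Omega> = (\<Union>i\<in>orb ` {..<n}. {\<alpha> i<..<\<beta> i})"
      using orb_bij by (simp add: bij_betw_def interval_union_def)
    then show "(\<Union>k\<in>{..<n}. {\<alpha> (orb k)<..<\<beta> (orb k)}) = \<Omega>" by simp
    show "disjoint_family_on P' {..<n}"
      unfolding disjoint_family_on_def
    proof (intro ballI impI)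
      have less: "P' j \<inter> P' k = {}" if "j < k" for j k
      proof -
        have "a (Suc j) \<le> a k" using that by (simp add: a_le_iff)
        then show ?thesis by (auto simp: P'_def)
      qed
      fix j k :: nat assume "j \<noteq> k"
      then show "P' j \<inter> P' k = {}" using less[of j k] less[of k j] by (cases "j < k") auto
    qed
    show "(\<Union>k\<in>{..<n}. P' k) = {\<alpha> 0<..<\<alpha> 0 + T}"
    proof (intro equalityI subsetI)
      fix y assume "y \<in> (\<Union>k\<in>{..<n}. P' k)"
      then obtain k where k: "k < n" "y \<in> P' k" by auto
      have "a (Suc k) \<le> a n" "a 0 \<le> a k" using k(1) by (auto simp only: a_le_iff)
      moreover have "k \<noteq> 0 \<Longrightarrow> a 0 < a k" by (simp only: a_less_iff)
      ultimately show "y \<in> {\<alpha> 0<..<\<alpha> 0 + T}"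
        using k(2) a_n by (auto simp: P'_def split: if_splits)
    next
      fix y assume y: "y \<in> {\<alpha> 0<..<\<alpha> 0 + T}"
      then obtain k where k: "k < n" "a k \<le> y" "y < a (Suc k)"
        using a_locate[of y n] a_n by auto
      then have "y \<in> P' k" using y by (auto simp: P'_def)
      then show "y \<in> (\<Union>k\<in>{..<n}. P' k)" using k by auto
    qed
    fix k assume k: "k \<in> {..<n}"
    show "{\<alpha> (orb k)<..<\<beta> (orb k)} \<in> sets lebesgue" "P' k \<in> sets lebesgue"
      by (auto simp: P'_def)
    have "(\<lambda>x. x + of_int (m k) * T) ` {\<alpha> (orb k)<..<\<beta> (orb k)} = {a k<..<a (Suc k)}"
      using shift_image[of k] m k by simp
    then have "sym_diff ((\<lambda>x. x + of_int (m k) * T) ` {\<alpha> (orb k)<..<\<beta> (orb k)}) (P' k) \<subseteq> {a k}"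
      using sub[of k] by auto
    then show "sym_diff ((\<lambda>x. x + of_int (m k) * T) ` {\<alpha> (orb k)<..<\<beta> (orb k)}) (P' k) \<in> null_sets lebesgue"
      using negligible_subset[OF negligible_sing] negligible_iff_null_sets by blast
  qed
qed

end

section \<open>The boundary matrix\<close>

context multiplicative_spectral_system
begin

context
  fixes c :: real
  assumes c_pos: "c > 0" and lattice: "\<Lambda> = {of_int k * c | k. True}"
begin

text \<open>Every multiple of \<open>1 / c\<close> is a common period of the exponentials with
  frequency in \<open>\<Lambda>\<close>.\<close>

lemma translates_disjoint:
  assumes "x \<in> \<Omega>" "x + of_int k * (1 / c) \<in> \<Omega>"
  shows "k = 0"
proof -
  have "of_int k * (1 / c) = 0"
  proof (rule no_period_in_Omega[OF _ assms])
    fix \<xi> assume "\<xi> \<in> \<Lambda>"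
    then obtain m :: int where "\<xi> = of_int m * c" using lattice by auto
    then have "2 * pi * \<xi> * (of_int k * (1 / c)) = 2 * pi * of_int (m * k)"
      using c_pos by (simp add: field_simps)
    then show "expo \<xi> (of_int k * (1 / c)) = 1"
      by (simp only: expo_cis) (rule cis_multiple_2pi, simp)
  qed
  then show ?thesis using c_pos by simp
qed

text \<open>If two left ends agree modulo \<open>1 / c\<close>, so do the points slightly to their
  right; these lie in \<open>\<Omega>\<close>, and disjointness of the translates applies.\<close>

lemma index_eq_if_left_eq:
  assumes i: "i < n" and j: "j < n" and eq: "expo c (\<alpha> i) = expo c (\<alpha> j)"
  shows "i = j"
proof -
  obtain k :: int where k: "\<alpha> i = \<alpha> j + of_int k * (1 / c)"
    using expo_eq_imp[OF c_pos eq] by blast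
  obtain \<epsilon> where \<epsilon>: "\<epsilon> > 0" "\<epsilon> < \<beta> i - \<alpha> i" "\<epsilon> < \<beta> j - \<alpha> j"
    using field_lbound_gt_zero[of "\<beta> i - \<alpha> i" "\<beta> j - \<alpha> j"] lt i j by auto
  have "k = 0"
  proof (rule translates_disjoint)
    show "\<alpha> j + \<epsilon> \<in> \<Omega>" using \<epsilon> by (intro in_Omega[OF j]) auto
    show "\<alpha> j + \<epsilon> + of_int k * (1 / c) \<in> \<Omega>" using \<epsilon> k by (intro in_Omega[OF i]) auto
  qed
  then show ?thesis using interval_unique[OF i j, of "\<alpha> j + \<epsilon>"] k \<epsilon> by auto
qed

text \<open>The mirror image, with points slightly to the left of the right ends. It makes
  \<open>\<sigma>\<close> injective.\<close>

lemma index_eq_if_right_eq: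
  assumes i: "i < n" and j: "j < n" and eq: "expo c (\<beta> i) = expo c (\<beta> j)"
  shows "i = j"
proof -
  obtain k :: int where k: "\<beta> i = \<beta> j + of_int k * (1 / c)"
    using expo_eq_imp[OF c_pos eq] by blast
  obtain \<epsilon> where \<epsilon>: "\<epsilon> > 0" "\<epsilon> < \<beta> i - \<alpha> i" "\<epsilon> < \<beta> j - \<alpha> j"
    using field_lbound_gt_zero[of "\<beta> i - \<alpha> i" "\<beta> j - \<alpha> j"] lt i j by auto
  have "k = 0"
  proof (rule translates_disjoint)
    show "\<beta> j - \<epsilon> \<in> \<Omega>" using \<epsilon> by (intro in_Omega[OF j]) auto
    show "\<beta> j - \<epsilon> + of_int k * (1 / c) \<in> \<Omega>" using \<epsilon> k by (intro in_Omega[OF i]) auto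
  qed
  then show ?thesis using interval_unique[OF i j, of "\<beta> j - \<epsilon>"] k \<epsilon> by auto
qed

text \<open>The powers of \<open>expo c\<close> are exponentials with frequency in the lattice
  \<open>\<Lambda>\<close>, so each satisfies the boundary condition; linearity extends it to
  polynomials.\<close>

lemma B_poly:
  fixes q :: "complex poly"
  assumes i: "i < n"
  shows "(\<Sum>j<n. B $$ (i, j) * poly q (expo c (\<alpha> j))) = poly q (expo c (\<beta> i))"
proof -
  have pow: "expo c x ^ m = expo (of_int (int m) * c) x" for x m
    by (simp add: expo_cis Complex.DeMoivre mult_ac)
  have B: "(\<Sum>j<n. B $$ (i, j) * expo c (\<alpha> j) ^ m) = expo c (\<beta> i) ^ m" for m
    unfolding pow by (rule B_expo[OF _ i]) (use lattice in blast)
  have "(\<Sum>j<n. B $$ (i, j) * poly q (expo c (\<alpha> j)))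
      = (\<Sum>j<n. \<Sum>m\<le>degree q. coeff q m * (B $$ (i, j) * expo c (\<alpha> j) ^ m))"
    by (simp add: poly_altdef sum_distrib_left mult_ac)
  also have "\<dots> = (\<Sum>m\<le>degree q. coeff q m * (\<Sum>j<n. B $$ (i, j) * expo c (\<alpha> j) ^ m))"
    by (subst sum.swap) (simp add: sum_distrib_left)
  also have "\<dots> = poly q (expo c (\<beta> i))" by (simp add: B poly_altdef)
  finally show ?thesis .
qed

text \<open>A polynomial vanishing at all \<open>expo c (\<alpha> j)\<close> vanishes at
  \<open>expo c (\<beta> i)\<close> by \<open>B_poly\<close>. For the product of the linear factors
  one factor must then be zero there.\<close>

lemma right_meets_left: "i < n \<Longrightarrow> \<exists>j<n. expo c (\<beta> i) = expo c (\<alpha> j)"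
proof (rule ccontr)
  assume i: "i < n" and none: "\<not> (\<exists>j<n. expo c (\<beta> i) = expo c (\<alpha> j))"
  define q where "q = (\<Prod>j<n. [:- expo c (\<alpha> j), 1:])"
  have q: "poly q x = (\<Prod>j<n. x - expo c (\<alpha> j))" for x
    by (simp add: q_def poly_prod)
  have "poly q (expo c (\<alpha> j)) = 0" if "j < n" for j
    unfolding q using that by (intro prod_zero) auto
  then have "poly q (expo c (\<beta> i)) = 0"
    unfolding B_poly[OF i, symmetric] by (intro sum.neutral) auto
  then show False using none by (auto simp: q)
qed

text \<open>The candidate chosen by \<open>SOME\<close> is unique by
  \<open>index_eq_if_left_eq\<close>. Fixing the numbers from \<open>n\<close> on is what
  \<open>permutes\<close> demands.\<close>

definition \<sigma> :: "nat \<Rightarrow> nat" where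
  "\<sigma> i = (if i < n then SOME j. j < n \<and> expo c (\<beta> i) = expo c (\<alpha> j) else i)"

lemma \<sigma>: "i < n \<Longrightarrow> \<sigma> i < n \<and> expo c (\<beta> i) = expo c (\<alpha> (\<sigma> i))"
  unfolding \<sigma>_def using someI_ex[OF right_meets_left] by auto

lemma interval_exchange_sigma: "interval_exchange n \<alpha> \<beta> (1 / c) \<sigma>"
proof unfold_locales
  have "inj_on \<sigma> {..<n}"
    using \<sigma> index_eq_if_right_eq by (intro inj_onI) (metis lessThan_iff)
  moreover have "\<sigma> ` {..<n} \<subseteq> {..<n}" using \<sigma> by auto
  ultimately have "bij_betw \<sigma> {..<n} {..<n}"
    using endo_inj_surj[of "{..<n}" \<sigma>] by (simp add: bij_betw_def)
  then show "\<sigma> permutes {..<n}" by (rule bij_imp_permutes) (simp add: \<sigma>_def)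
  show "\<exists>k::int. \<beta> i = \<alpha> (\<sigma> i) + of_int k * (1 / c)" if "i < n" for i
    using expo_eq_imp[OF c_pos] \<sigma>[OF that] by blast
qed (use c_pos translates_disjoint in auto)

text \<open>With a Lagrange-type polynomial that vanishes at every
  \<open>expo c (\<alpha> m)\<close> except the one for \<open>m = j\<close>, \<open>B_poly\<close>
  isolates the entry \<open>(i, j)\<close>; its right side is the value at
  \<open>expo c (\<alpha> (\<sigma> i))\<close>, which is nonzero exactly for
  \<open>\<sigma> i = j\<close>.\<close>

lemma B_eq: "B = permutation_matrix n \<sigma>"
proof (rule eq_matI)
  fix i j assume "i < dim_row (permutation_matrix n \<sigma>)" "j < dim_col (permutation_matrix n \<sigma>)"
  then have ij: "i < n" "j < n" by (auto simp: permutation_matrix_def)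
  define q where "q = (\<Prod>m\<in>{..<n} - {j}. [:- expo c (\<alpha> m), 1:])"
  have q: "poly q x = (\<Prod>m\<in>{..<n} - {j}. x - expo c (\<alpha> m))" for x
    by (simp add: q_def poly_prod)
  have q0: "poly q (expo c (\<alpha> m)) = 0" if "m < n" "m \<noteq> j" for m
    unfolding q using that by (intro prod_zero) auto
  have q1: "poly q (expo c (\<alpha> j)) \<noteq> 0"
    unfolding q using index_eq_if_left_eq ij by (auto simp: prod_zero_iff)
  have "(\<Sum>m<n. B $$ (i, m) * poly q (expo c (\<alpha> m))) = (\<Sum>m<n. if m = j then B $$ (i, j) * poly q (expo c (\<alpha> j)) else 0)"
    by (intro sum.cong) (auto simp: q0)
  also have "\<dots> = B $$ (i, j) * poly q (expo c (\<alpha> j))" using ij by (simp add: sum.delta)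
  finally have "B $$ (i, j) * poly q (expo c (\<alpha> j)) = poly q (expo c (\<alpha> (\<sigma> i)))"
    using B_poly[OF ij(1), of q] \<sigma>[OF ij(1)] by simp
  then have "B $$ (i, j) = (if \<sigma> i = j then 1 else 0)"
    using q0[of "\<sigma> i"] q1 \<sigma>[OF ij(1)] by (auto split: if_splits)
  then show "B $$ (i, j) = permutation_matrix n \<sigma> $$ (i, j)"
    using ij by (simp add: permutation_matrix_def)
qed (use B_carrier in \<open>auto simp: permutation_matrix_def\<close>)

end

end

section \<open>Assembly of the three assertions\<close>

theorem theorem4p7:
  fixes n :: nat and \<alpha> \<beta> :: "nat \<Rightarrow> real" and \<Omega> \<Lambda> :: "real set"
    and B :: "complex mat" and U :: "real \<Rightarrow> (real \<Rightarrow> complex) \<Rightarrow> (real \<Rightarrow> complex)"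
    and L :: real
  assumes "n \<ge> 1"
    and "\<forall>i<n. \<alpha> i < \<beta> i"
    and "\<forall>i. Suc i < n \<longrightarrow> \<beta> i < \<alpha> (Suc i)"
    and "\<Omega> = interval_union n \<alpha> \<beta>"
    and "spectral_with \<Omega> \<Lambda>"
    and "unitary_matrix n B"
    and "\<forall>\<xi>\<in>\<Lambda>. B *\<^sub>v left_values n \<alpha> (expo \<xi>) = right_values n \<beta> (expo \<xi>)"
    and "unitary_group_of \<Omega> (D_op n \<alpha> \<beta> B) U"
    and "multiplicative_group \<Omega> U"
    and "L = measure lebesgue \<Omega>"
  shows "\<exists>\<sigma>.
      (full_cycle n \<sigma> \<and> B = permutation_matrix n \<sigma>) \<and>
      (L = (\<Sum>i<n. \<beta> i - \<alpha> i) \<and>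
       \<Lambda> = {of_int k / L | k :: int. True} \<and>
       tiles_reals \<Omega> {of_int k * L | k :: int. True}) \<and>
      (\<forall>k. 1 \<le> k \<and> k \<le> n - 1 \<longrightarrow>
         (\<lambda>x. x + shift \<alpha> \<beta> \<sigma> k) ` {\<alpha> ((\<sigma> ^^ k) 0)<..<\<beta> ((\<sigma> ^^ k) 0)} =
         {\<alpha> 0 + (\<Sum>j<k. \<beta> ((\<sigma> ^^ j) 0) - \<alpha> ((\<sigma> ^^ j) 0))<..<
          \<alpha> 0 + (\<Sum>j\<le>k. \<beta> ((\<sigma> ^^ j) 0) - \<alpha> ((\<sigma> ^^ j) 0))}) \<and>
      (\<exists>F. finite F \<and>
         {\<alpha> 0<..<\<beta> 0} \<union>
         (\<Union>k\<in>{1..n - 1}. (\<lambda>x. x + shift \<alpha> \<beta> \<sigma> k) ` {\<alpha> ((\<sigma> ^^ k) 0)<..<\<beta> ((\<sigma> ^^ k) 0)}) =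
         {\<alpha> 0<..<\<alpha> 0 + L} - F) \<and>
      (\<forall>k. 1 \<le> k \<and> k \<le> n - 1 \<longrightarrow> (\<exists>m::int. shift \<alpha> \<beta> \<sigma> k = of_int m * L)) \<and>
      (\<exists>P' m. (\<forall>k<n. shift \<alpha> \<beta> \<sigma> k = of_int (m k) * L) \<and>
         translation_congruence_via L \<Omega> {\<alpha> 0<..<\<alpha> 0 + L} {..<n}
           (\<lambda>k. {\<alpha> ((\<sigma> ^^ k) 0)<..<\<beta> ((\<sigma> ^^ k) 0)}) P' m) \<and>
      translation_congruent L \<Omega> {\<alpha> 0<..<\<alpha> 0 + L}"
proof -
  interpret S: multiplicative_spectral_system n \<alpha> \<beta> \<Lambda> B U
    using assms by unfold_locales (auto simp: unitary_matrix_def)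
  obtain c where c: "c > 0" "\<Lambda> = {of_int k * c | k. True}" by (rule S.spectrum_lattice)
  obtain \<sigma> where \<sigma>: "interval_exchange n \<alpha> \<beta> (1 / c) \<sigma>" "B = permutation_matrix n \<sigma>"
    using S.interval_exchange_sigma[OF c] S.B_eq[OF c] by blast
  interpret X: interval_exchange n \<alpha> \<beta> "1 / c" \<sigma> by (rule \<sigma>(1))
  have L_eq: "L = (\<Sum>i<n. \<beta> i - \<alpha> i)" using assms(4,10) S.measure_Omega by simp
  \<comment> \<open>The period dual to the spectrum equals the total length, which identifies the
    generator of \<open>\<Lambda>\<close> as \<open>1 / L\<close>.\<close>
  have L: "1 / c = L" unfolding L_eq by (rule X.T_eq)
  then have \<Lambda>: "\<Lambda> = {of_int k / L | k :: int. True}" using c by auto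
  have shift_lattice: "\<exists>m::int. shift \<alpha> \<beta> \<sigma> k = of_int m * L" for k
    using X.shift_lattice[of k] unfolding L .
  have image: "(\<lambda>x. x + shift \<alpha> \<beta> \<sigma> k) ` {\<alpha> ((\<sigma> ^^ k) 0)<..<\<beta> ((\<sigma> ^^ k) 0)} = {X.a k<..<X.a (Suc k)}" for k
    using X.shift_image[of k] by (simp add: X.orb_def)
  have union: "\<exists>F. finite F \<and> {\<alpha> 0<..<\<beta> 0} \<union>
         (\<Union>k\<in>{1..n - 1}. (\<lambda>x. x + shift \<alpha> \<beta> \<sigma> k) ` {\<alpha> ((\<sigma> ^^ k) 0)<..<\<beta> ((\<sigma> ^^ k) 0)}) =
         {\<alpha> 0<..<\<alpha> 0 + L} - F"
    unfolding image using X.union_moved unfolding L .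
  obtain m :: "nat \<Rightarrow> int" where m: "\<And>k. shift \<alpha> \<beta> \<sigma> k = of_int (m k) * L"
    using shift_lattice by metis
  obtain P' where P': "translation_congruence_via L \<Omega> {\<alpha> 0<..<\<alpha> 0 + L} {..<n}
           (\<lambda>k. {\<alpha> ((\<sigma> ^^ k) 0)<..<\<beta> ((\<sigma> ^^ k) 0)}) P' m"
    using X.congruence[of m] m unfolding L X.orb_def assms(4) by blast
  have piece: "{X.a k<..<X.a (Suc k)} =
         {\<alpha> 0 + (\<Sum>j<k. \<beta> ((\<sigma> ^^ j) 0) - \<alpha> ((\<sigma> ^^ j) 0))<..<
          \<alpha> 0 + (\<Sum>j\<le>k. \<beta> ((\<sigma> ^^ j) 0) - \<alpha> ((\<sigma> ^^ j) 0))}" for k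
    by (simp only: X.a_def X.orb_def lessThan_Suc_atMost)
  show ?thesis
  proof (rule exI[of _ \<sigma>], intro conjI)
    show "tiles_reals \<Omega> {of_int k * L | k :: int. True}"
      using X.tiles unfolding L assms(4) .
    show "\<forall>k. 1 \<le> k \<and> k \<le> n - 1 \<longrightarrow>
         (\<lambda>x. x + shift \<alpha> \<beta> \<sigma> k) ` {\<alpha> ((\<sigma> ^^ k) 0)<..<\<beta> ((\<sigma> ^^ k) 0)} =
         {\<alpha> 0 + (\<Sum>j<k. \<beta> ((\<sigma> ^^ j) 0) - \<alpha> ((\<sigma> ^^ j) 0))<..<
          \<alpha> 0 + (\<Sum>j\<le>k. \<beta> ((\<sigma> ^^ j) 0) - \<alpha> ((\<sigma> ^^ j) 0))}"
      unfolding image piece by simp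
    show "\<forall>k. 1 \<le> k \<and> k \<le> n - 1 \<longrightarrow> (\<exists>m::int. shift \<alpha> \<beta> \<sigma> k = of_int m * L)"
      using shift_lattice by simp
    show "\<exists>P' m. (\<forall>k<n. shift \<alpha> \<beta> \<sigma> k = of_int (m k) * L) \<and>
         translation_congruence_via L \<Omega> {\<alpha> 0<..<\<alpha> 0 + L} {..<n}
           (\<lambda>k. {\<alpha> ((\<sigma> ^^ k) 0)<..<\<beta> ((\<sigma> ^^ k) 0)}) P' m"
      using m P' by (intro exI[of _ P'] exI[of _ m]) simp
    show "translation_congruent L \<Omega> {\<alpha> 0<..<\<alpha> 0 + L}"
      unfolding translation_congruent_def using P' by (intro exI)
  qed (rule X.full_cycle \<sigma>(2) L_eq \<Lambda> union)+
qed

end
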